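(* Let $b\ge 2$ be a natural number, identified with $\{0,1,\dots,b-1\}$. Let $\Omega$ be a standard Borel space and let $G$ be a symmetric Borel graph on $\Omega$ (as defined in the context). Let $\mathbf R$ be a Borel local rule on $G$. Assume that the graph $\mathrm{Rel}(G)$ is of uniformly subexponential growth, and let $\Delta$ be the maximal degree of a vertex in $\mathrm{Rel}(G)$. For $x\in\Omega$ let $p(x):=1-\frac{|\mathbf R(x)|}{b^{\deg(x)}}$, where $\deg(x)=|N(x)|$. If $p(x)<\frac{1}{e\Delta}$ for all $x\in\Omega$, then there exists a Borel function $f\colon \Omega\to b$ which satisfies $\mathbf R$.
   Context: A Borel arrow on a standard Borel space $\Omega$ is a pair $(U,\gamma)$ with $U\subseteq\Omega$ Borel and $\gamma\colon U\to\Omega$ a Borel isomorphism onto its image. A Borel graph on $\Omega$ is an oriented graph $G$ with vertex set $\Omega$ and edge set $\{(x,y): \exists i\ (x\in U_i,\ \gamma_i(x)=y)\}$ for some countable sequence $S=((U_1,\gamma_1),(U_2,\gamma_2),\dots)$ of Borel arrows (self-loops allowed, at most one per vertex); it is symmetric if $(x,y)\in E(G)\iff(y,x)\in E(G)$. The neighbourhood of $x$ is $N(x)=\{y:(x,y)\in E(G)\}$; its degree is $|N(x)|$ (a self-loop counts once). $N(x)$ is well-ordered by: $y<z$ iff the least $i$ with $x\in U_i,\gamma_i(x)=y$ is smaller than the least $j$ with $x\in U_j,\gamma_j(x)=z$. A local rule assigns to each $x$ a set $\mathbf R(x)$ of functions $N(x)\to b$. Letting $\iota_x\colon |N(x)|\to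 N(x)$ be the order isomorphism and $\mathbb S$ the set of finite $b$-valued sequences, put $\mathbf R'(x)=\{g\circ\iota_x: g\in\mathbf R(x)\}\subseteq\mathbb S$; $\mathbf R$ is Borel if $\{x:\mathbf R'(x)=A\}$ is Borel for every $A\subseteq\mathbb S$. A function $f\colon\Omega\to b$ satisfies $\mathbf R$ if $f|_{N(x)}\in\mathbf R(x)$ for all $x$. $\mathrm{Rel}(G)$ is the graph on $\Omega$ with an edge between $x$ and $y$ (possibly $x=y$) iff $N(x)\cap N(y)\neq\emptyset$; degrees count a self-loop once. A graph is of uniformly subexponential growth if for every $\varepsilon>0$ there is $r$ such that for all $R>r$ and all vertices $v$, the set of vertices at graph distance at most $R$ from $v$ has fewer than $(1+\varepsilon)^R$ elements. *)

theory Defs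
  imports "HOL-Analysis.Analysis" "HOL-Library.FuncSet"
begin

text \<open>A standard Borel space is represented (up to Borel isomorphism) by a type
  of class polish_space with its Borel sigma-algebra.  A countable sequence of
  Borel arrows is a map S :: nat => ('a set * ('a => 'a)).\<close>

definition borel_arrow :: "'a::topological_space set \<Rightarrow> ('a \<Rightarrow> 'a) \<Rightarrow> bool" where
  "borel_arrow U \<gamma> \<longleftrightarrow>
     U \<in> sets borel \<and> inj_on \<gamma> U \<and>
     (\<forall>B \<in> sets borel. U \<inter> \<gamma> -` B \<in> sets borel) \<and>
     (\<forall>B \<in> sets borel. \<gamma> ` (U \<inter> B) \<in> sets borel)"

definition borel_arrow_seq :: "(nat \<Rightarrow> 'a::topological_space set \<times> ('a \<Rightarrow> 'a)) \<Rightarrow> bool" where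
  "borel_arrow_seq S \<longleftrightarrow> (\<forall>i. borel_arrow (fst (S i)) (snd (S i)))"

definition gedge :: "(nat \<Rightarrow> 'a set \<times> ('a \<Rightarrow> 'a)) \<Rightarrow> 'a \<Rightarrow> 'a \<Rightarrow> bool" where
  "gedge S x y \<longleftrightarrow> (\<exists>i. x \<in> fst (S i) \<and> snd (S i) x = y)"

definition nbhd :: "(nat \<Rightarrow> 'a set \<times> ('a \<Rightarrow> 'a)) \<Rightarrow> 'a \<Rightarrow> 'a set" where
  "nbhd S x = {y. gedge S x y}"

definition symmetric_graph :: "(nat \<Rightarrow> 'a set \<times> ('a \<Rightarrow> 'a)) \<Rightarrow> bool" where
  "symmetric_graph S \<longleftrightarrow> (\<forall>x y. gedge S x y \<longleftrightarrow> gedge S y x)"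

definition gdeg :: "(nat \<Rightarrow> 'a set \<times> ('a \<Rightarrow> 'a)) \<Rightarrow> 'a \<Rightarrow> nat" where
  "gdeg S x = card (nbhd S x)"

text \<open>Indices i that are the least index producing their neighbour of x.
  Listing them increasingly and applying the arrows gives the neighbours of x
  in the well-order of the paper, i.e. the map iota_x.\<close>
definition first_indices :: "(nat \<Rightarrow> 'a set \<times> ('a \<Rightarrow> 'a)) \<Rightarrow> 'a \<Rightarrow> nat set" where
  "first_indices S x = {i. x \<in> fst (S i) \<and>
      (\<forall>j<i. \<not> (x \<in> fst (S j) \<and> snd (S j) x = snd (S i) x))}"

definition nbr_list :: "(nat \<Rightarrow> 'a set \<times> ('a \<Rightarrow> 'a)) \<Rightarrow> 'a \<Rightarrow> 'a list" where
  "nbr_list S x = map (\<lambda>i. snd (S i) x) (sorted_list_of_set (first_indices S x))"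

definition local_rule :: "(nat \<Rightarrow> 'a set \<times> ('a \<Rightarrow> 'a)) \<Rightarrow> nat \<Rightarrow> ('a \<Rightarrow> ('a \<Rightarrow> nat) set) \<Rightarrow> bool" where
  "local_rule S b R \<longleftrightarrow> (\<forall>x. R x \<subseteq> (nbhd S x \<rightarrow>\<^sub>E {..<b}))"

definition rule_seqs :: "(nat \<Rightarrow> 'a set \<times> ('a \<Rightarrow> 'a)) \<Rightarrow> ('a \<Rightarrow> ('a \<Rightarrow> nat) set) \<Rightarrow> 'a \<Rightarrow> nat list set" where
  "rule_seqs S R x = (\<lambda>g. map g (nbr_list S x)) ` R x"

definition borel_rule :: "(nat \<Rightarrow> 'a::topological_space set \<times> ('a \<Rightarrow> 'a)) \<Rightarrow> ('a \<Rightarrow> ('a \<Rightarrow> nat) set) \<Rightarrow> bool" where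
  "borel_rule S R \<longleftrightarrow> (\<forall>A :: nat list set. {x. rule_seqs S R x = A} \<in> sets borel)"

definition satisfies_rule :: "(nat \<Rightarrow> 'a set \<times> ('a \<Rightarrow> 'a)) \<Rightarrow> ('a \<Rightarrow> ('a \<Rightarrow> nat) set) \<Rightarrow> ('a \<Rightarrow> nat) \<Rightarrow> bool" where
  "satisfies_rule S R f \<longleftrightarrow> (\<forall>x. restrict f (nbhd S x) \<in> R x)"

definition rel_adj :: "(nat \<Rightarrow> 'a set \<times> ('a \<Rightarrow> 'a)) \<Rightarrow> 'a \<Rightarrow> 'a \<Rightarrow> bool" where
  "rel_adj S x y \<longleftrightarrow> nbhd S x \<inter> nbhd S y \<noteq> {}"

definition rel_deg :: "(nat \<Rightarrow> 'a set \<times> ('a \<Rightarrow> 'a)) \<Rightarrow> 'a \<Rightarrow> nat" where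
  "rel_deg S x = card {y. rel_adj S x y}"

definition rel_ball :: "(nat \<Rightarrow> 'a set \<times> ('a \<Rightarrow> 'a)) \<Rightarrow> 'a \<Rightarrow> nat \<Rightarrow> 'a set" where
  "rel_ball S v R = {w. \<exists>k\<le>R. (v, w) \<in> ({(x, y). rel_adj S x y} ^^ k)}"

definition rel_unif_subexp_growth :: "(nat \<Rightarrow> 'a set \<times> ('a \<Rightarrow> 'a)) \<Rightarrow> bool" where
  "rel_unif_subexp_growth S \<longleftrightarrow>
     (\<forall>\<epsilon>::real. \<epsilon> > 0 \<longrightarrow> (\<exists>r::nat. \<forall>R::nat. R > r \<longrightarrow>
        (\<forall>v. finite (rel_ball S v R) \<and> real (card (rel_ball S v R)) < (1 + \<epsilon>) ^ R)))"

end

(* A Moser-Tardos resampling procedure is run with shared randomness. Colour the vertices with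
   finitely many colours in a Borel way so that vertices close to each other in Rel(G) get distinct
   colours; the values used by a variable at its successive resamplings depend only on its colour and
   are read off a finite table, the seed. If every clause is resampled boundedly often, the procedure
   converges to a Borel function satisfying the rule.

   If some clause x is resampled M times while no clause is resampled more often, then, since the
   balls around x grow slowly, there are a radius j below a bound r independent of M and balls
   B(x,j), B(x,j+1) such that the larger one sees at most (1 + epsilon) times as many resamplings as
   the smaller one. The order of the resamplings in B(x,j+1) determines which entries of the seed
   were read by the clauses in B(x,j), and these entries are distinct because the colours are. Thus a
   history with w inner resamplings out of v is consistent with a random seed with probability at
   most p^w, which is at most theta^M (1 / (e Delta))^v for some theta < 1, and the sum of
   (1 / (e Delta))^v over all histories is bounded. Up to replacing vertices by colours only finitely
   many configurations arise, and their number does not depend on M, so for large M a union bound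
   yields one seed that works simultaneously at all vertices. *)
theory Submission
  imports Defs
begin

section \<open>Borel multifunctions and Borel colourings\<close>

text \<open>Measurability of a set-valued map is tested on all Borel sets and not just on open ones:
  then compositions are immediate, and a Borel set of clauses has a Borel set of variables.\<close>

definition borel_multifun :: "('a::topological_space \<Rightarrow> 'b::topological_space set) \<Rightarrow> bool" where
  "borel_multifun H \<longleftrightarrow> (\<forall>B \<in> sets borel. {x. H x \<inter> B \<noteq> {}} \<in> sets borel)"

lemma borel_multifunD: "borel_multifun H \<Longrightarrow> B \<in> sets borel \<Longrightarrow> {x. H x \<inter> B \<noteq> {}} \<in> sets borel"
  by (simp add: borel_multifun_def)

lemma borel_multifun_comp:
  assumes "borel_multifun H" "borel_multifun K"
  shows "borel_multifun (\<lambda>x. \<Union>y\<in>H x. K y)"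
  unfolding borel_multifun_def
proof
  fix B :: "'c set" assume B: "B \<in> sets borel"
  have "{x. (\<Union>y\<in>H x. K y) \<inter> B \<noteq> {}} = {x. H x \<inter> {y. K y \<inter> B \<noteq> {}} \<noteq> {}}"
    by auto
  then show "{x. (\<Union>y\<in>H x. K y) \<inter> B \<noteq> {}} \<in> sets borel"
    using borel_multifunD[OF assms(1)] borel_multifunD[OF assms(2) B] by simp
qed

lemma borel_multifun_singleton: "borel_multifun (\<lambda>x. {x})"
  by (auto simp: borel_multifun_def)

lemma borel_multifun_UN:
  assumes "countable A" "\<And>i. i \<in> A \<Longrightarrow> borel_multifun (H i)"
  shows "borel_multifun (\<lambda>x. \<Union>i\<in>A. H i x)"
  unfolding borel_multifun_def
proof
  fix B :: "'c set" assume B: "B \<in> sets borel"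
  have "{x. (\<Union>i\<in>A. H i x) \<inter> B \<noteq> {}} = (\<Union>i\<in>A. {x. H i x \<inter> B \<noteq> {}})"
    by auto
  then show "{x. (\<Union>i\<in>A. H i x) \<inter> B \<noteq> {}} \<in> sets borel"
    using assms borel_multifunD[OF assms(2) B] by (auto intro!: sets.countable_UN')
qed

text \<open>Finite sets are closed in a T1 space. The countable family turns inequality of points
  into a countable union of Borel conditions.\<close>

lemma separating_basis:
  obtains \<B> :: "'a::{second_countable_topology,t1_space} set set"
  where "countable \<B>" "\<And>U. U \<in> \<B> \<Longrightarrow> U \<in> sets borel"
    "\<And>x F. finite F \<Longrightarrow> x \<notin> F \<Longrightarrow> \<exists>U\<in>\<B>. x \<in> U \<and> F \<inter> U = {}"
proof -
  obtain \<B> :: "'a set set" where \<B>: "countable \<B>" "topological_basis \<B>"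
    using ex_countable_basis by blast
  show ?thesis
  proof
    show "countable \<B>" by fact
    show "U \<in> sets borel" if "U \<in> \<B>" for U
      using topological_basis_open[OF \<B>(2) that] by simp
    show "\<exists>U\<in>\<B>. x \<in> U \<and> F \<inter> U = {}" if "finite F" "x \<notin> F" for x F
    proof -
      have "open (- F)" "x \<in> - F" using that finite_imp_closed by auto
      with \<B>(2) show ?thesis by (meson topological_basisE disjoint_eq_subset_Compl inf_commute ComplD disjoint_iff subsetD)
    qed
  qed
qed

text \<open>A point \<open>y\<close> differs from \<open>x\<close> iff some separating set
  \<open>U\<close> contains \<open>y\<close> but not \<open>x\<close>; for fixed \<open>U\<close>
  the conditions on \<open>y\<close> and on \<open>x\<close> decouple.\<close>

lemma borel_multifun_remove_self:
  fixes H :: "'a::{second_countable_topology,t1_space} \<Rightarrow> 'a set"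
  assumes "borel_multifun H"
  shows "borel_multifun (\<lambda>x. H x - {x})"
  unfolding borel_multifun_def
proof
  fix B :: "'a set" assume B: "B \<in> sets borel"
  obtain \<B> :: "'a set set" where \<B>: "countable \<B>" "\<And>U. U \<in> \<B> \<Longrightarrow> U \<in> sets borel"
    "\<And>x F. finite F \<Longrightarrow> x \<notin> F \<Longrightarrow> \<exists>U\<in>\<B>. x \<in> U \<and> F \<inter> U = {}"
    using separating_basis by blast
  have "{x. (H x - {x}) \<inter> B \<noteq> {}} = (\<Union>U\<in>\<B>. {x. H x \<inter> (B \<inter> U) \<noteq> {}} - U)" (is "?l = ?r")
  proof
    show "?l \<subseteq> ?r"
    proof
      fix x assume "x \<in> ?l"
      then obtain y where "y \<in> H x" "y \<in> B" "y \<notin> {x}" by blast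
      then show "x \<in> ?r" using \<B>(3)[of "{x}" y] by blast
    qed
  qed auto
  then show "{x. (H x - {x}) \<inter> B \<noteq> {}} \<in> sets borel"
    using borel_multifunD[OF assms] B \<B>(1,2) by (auto intro!: sets.countable_UN')
qed

lemma greedy_avoiding_color:
  fixes c :: "'b \<Rightarrow> nat"
  assumes "finite A" "card A < k"
  shows "(LEAST j. \<forall>y\<in>A. c y \<noteq> j) < k" "\<forall>y\<in>A. c y \<noteq> (LEAST j. \<forall>y\<in>A. c y \<noteq> j)"
proof -
  have "card (c ` A) < card {..<k}" using assms card_image_le[of A c] by simp
  then have "\<not> {..<k} \<subseteq> c ` A" using assms by (meson card_mono finite_imageI linorder_not_less)
  then obtain j where "j < k" "\<forall>y\<in>A. c y \<noteq> j" by force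
  then show "(LEAST j. \<forall>y\<in>A. c y \<noteq> j) < k"
    using Least_le[of "\<lambda>j. \<forall>y\<in>A. c y \<noteq> j" j] \<open>\<forall>y\<in>A. c y \<noteq> j\<close> \<open>j < k\<close> by simp
  show "\<forall>y\<in>A. c y \<noteq> (LEAST j. \<forall>y\<in>A. c y \<noteq> j)"
    using \<open>\<forall>y\<in>A. c y \<noteq> j\<close> by (rule LeastI)
qed

text \<open>A vertex takes the index of the first separating set that contains it and misses all its
  neighbours. A neighbour with the same index would lie in that set.\<close>

lemma borel_countable_coloring:
  fixes H :: "'a::{second_countable_topology,t1_space} \<Rightarrow> 'a set"
  assumes H: "borel_multifun H" and irr: "\<And>x. x \<notin> H x" and fin: "\<And>x. finite (H x)"
  obtains c :: "'a \<Rightarrow> nat" where "\<And>j. {x. c x = j} \<in> sets borel" "\<And>x y. y \<in> H x \<Longrightarrow> c y \<noteq> c x"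
proof -
  obtain \<B> :: "'a set set" where \<B>: "countable \<B>" "\<And>U. U \<in> \<B> \<Longrightarrow> U \<in> sets borel"
    "\<And>x F. finite F \<Longrightarrow> x \<notin> F \<Longrightarrow> \<exists>U\<in>\<B>. x \<in> U \<and> F \<inter> U = {}"
    using separating_basis by blast
  have "\<B> \<noteq> {}" using \<B>(3)[of "{}"] by blast
  define U where "U = from_nat_into \<B>"
  have U: "range U = \<B>" unfolding U_def using \<B>(1) \<open>\<B> \<noteq> {}\<close> by (rule range_from_nat_into[rotated])
  then have Ub[measurable]: "U n \<in> sets borel" for n using \<B>(2) by blast
  define P where "P x n \<longleftrightarrow> x \<in> U n \<and> H x \<inter> U n = {}" for x n
  have ex: "\<exists>n. P x n" for x
    using \<B>(3)[OF fin irr, of x] U unfolding P_def by (metis rangeE)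
  have Pm: "{x. P x n} \<in> sets borel" for n
  proof -
    have "{x. P x n} = U n - {x. H x \<inter> U n \<noteq> {}}" unfolding P_def by auto
    then show ?thesis using borel_multifunD[OF H Ub] by simp
  qed
  define c where "c x = (LEAST n. P x n)" for x
  have cP: "P x (c x)" for x unfolding c_def using ex by (rule LeastI_ex)
  show ?thesis
  proof
    fix j
    have "{x. c x = j} = {x. P x j} - (\<Union>i\<in>{..<j}. {x. P x i})"
      using cP by (auto simp: c_def dest: not_less_Least intro!: Least_equality)
        (use linorder_not_less in blast)
    then show "{x. c x = j} \<in> sets borel" using Pm by auto
  next
    show "c y \<noteq> c x" if "y \<in> H x" for x y
      using cP[of x] cP[of y] that unfolding P_def by auto
  qed
qed

lemma borel_finite_coloring:
  fixes H :: "'a::{second_countable_topology,t1_space} \<Rightarrow> 'a set"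
  assumes H: "borel_multifun H" and irr: "\<And>x. x \<notin> H x" and symm: "\<And>x y. y \<in> H x \<Longrightarrow> x \<in> H y"
    and fin: "\<And>x. finite (H x)" and deg: "\<And>x. card (H x) < k"
  obtains c :: "'a \<Rightarrow> nat"
  where "\<And>j. {x. c x = j} \<in> sets borel" "\<And>x. c x < k" "\<And>x y. y \<in> H x \<Longrightarrow> c y \<noteq> c x"
proof -
  obtain c0 :: "'a \<Rightarrow> nat" where c0: "\<And>j. {x. c0 x = j} \<in> sets borel" "\<And>x y. y \<in> H x \<Longrightarrow> c0 y \<noteq> c0 x"
    using borel_countable_coloring[OF H irr fin] by blast
  define A where "A x = {y \<in> H x. c0 y < c0 x}" for x
  define c :: "'a \<Rightarrow> nat" where "c = wfrec (inv_image less_than c0) (\<lambda>g x. LEAST j. \<forall>y\<in>A x. g y \<noteq> j)"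
  have c: "c x = (LEAST j. \<forall>y\<in>A x. c y \<noteq> j)" for x
    by (subst def_wfrec[OF c_def[THEN eq_reflection]]) (auto simp: A_def cut_apply)
  have finA: "finite (A x)" and "card (A x) \<le> card (H x)" for x
    using fin[of x] by (auto simp: A_def intro!: card_mono)
  then have degA: "card (A x) < k" for x using deg le_less_trans by blast
  have greedy: "c x < k" "\<forall>y\<in>A x. c y \<noteq> c x" for x
    using greedy_avoiding_color[OF finA degA, of x c] by (simp_all add: c[of x, symmetric])
  have least: "\<exists>y\<in>A x. c y = i" if "i < c x" for x i
    using not_less_Least[of i "\<lambda>j. \<forall>y\<in>A x. c y \<noteq> j"] that by (simp add: c[of x, symmetric])
  \<comment> \<open>Whether \<open>c x = j\<close> depends only on which colours occur in
    \<open>A x\<close>, and on a fixed level of \<open>c0\<close> this is whether \<open>H x\<close>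
    meets the sets \<open>E i\<close> built from lower levels. Measurability follows level by
    level.\<close>
  have c_eq: "c x = j \<longleftrightarrow> (\<forall>i<j. \<exists>y\<in>A x. c y = i) \<and> (\<forall>y\<in>A x. c y \<noteq> j)" for x j
    using greedy(2)[of x] least[of _ x] by (metis linorder_neqE_nat)
  have meas: "{x. c0 x = n \<and> c x = j} \<in> sets borel" for n j
  proof (induction n arbitrary: j rule: less_induct)
    case (less n)
    define E where "E i = (\<Union>n'\<in>{..<n}. {x. c0 x = n' \<and> c x = i})" for i
    have E: "E i \<in> sets borel" for i unfolding E_def using less by auto
    have HE: "{x. H x \<inter> E i \<noteq> {}} \<in> sets borel" for i using borel_multifunD[OF H E] .
    have "{x. c0 x = n \<and> c x = j} =
        {x. c0 x = n} \<inter> (\<Inter>i\<in>{..<j}. {x. H x \<inter> E i \<noteq> {}}) - {x. H x \<inter> E j \<noteq> {}}"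
      (is "?l = ?r")
    proof (rule set_eqI)
      fix x
      have AE: "(\<exists>y\<in>A x. c y = i) \<longleftrightarrow> H x \<inter> E i \<noteq> {}" if "c0 x = n" for i
        using that by (auto simp: A_def E_def)
      show "x \<in> ?l \<longleftrightarrow> x \<in> ?r"
        using c_eq[of x j] AE by (cases "c0 x = n") auto
    qed
    moreover have "{x. c0 x = n} \<inter> (\<Inter>i\<in>{..<j}. {x. H x \<inter> E i \<noteq> {}}) \<in> sets borel"
      using c0(1) HE by (cases "j = 0") (auto intro!: sets.Int sets.finite_INT simp: lessThan_empty_iff)
    ultimately show ?case using HE by auto
  qed
  show ?thesis
  proof
    fix j
    have "{x. c x = j} = (\<Union>n. {x. c0 x = n \<and> c x = j})" by auto
    then show "{x. c x = j} \<in> sets borel" using meas by auto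
    show "c x < k" for x by (rule greedy)
    show "c y \<noteq> c x" if "y \<in> H x" for x y
    proof (cases "c0 y < c0 x")
      case True
      then have "y \<in> A x" using that by (simp add: A_def)
      then show ?thesis using greedy(2) by blast
    next
      case False
      then have "c0 x < c0 y" using c0(2)[OF that] by simp
      then have "x \<in> A y" using symm[OF that] by (simp add: A_def)
      then show ?thesis using greedy(2)[of y] by metis
    qed
  qed
qed

section \<open>The graph as a Borel multifunction\<close>

lemma borel_multifun_nbhd:
  assumes "borel_arrow_seq S"
  shows "borel_multifun (nbhd S)"
  unfolding borel_multifun_def
proof
  fix B :: "'a set" assume B: "B \<in> sets borel"
  have "{x. nbhd S x \<inter> B \<noteq> {}} = (\<Union>i. fst (S i) \<inter> snd (S i) -` B)"
    by (auto simp: nbhd_def gedge_def)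
  then show "{x. nbhd S x \<inter> B \<noteq> {}} \<in> sets borel"
    using assms B by (auto simp: borel_arrow_seq_def borel_arrow_def)
qed

text \<open>In a symmetric graph a common neighbour is the midpoint of a path of length two, so
  neighbourhoods in Rel(G) are compositions of Borel multifunctions.\<close>

lemma rel_adj_eq: "symmetric_graph S \<Longrightarrow> {y. rel_adj S x y} = (\<Union>z\<in>nbhd S x. nbhd S z)"
  by (auto simp: rel_adj_def nbhd_def symmetric_graph_def)

lemma borel_multifun_rel_ball:
  assumes "borel_arrow_seq S" "symmetric_graph S"
  shows "borel_multifun (\<lambda>x. rel_ball S x n)"
proof -
  let ?E = "{(x, y). rel_adj S x y}"
  have adj: "borel_multifun (\<lambda>x. {y. rel_adj S x y})"
    unfolding rel_adj_eq[OF assms(2)] using borel_multifun_nbhd[OF assms(1)] by (intro borel_multifun_comp)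
  have "borel_multifun (\<lambda>x. {w. (x, w) \<in> ?E ^^ k})" for k
  proof (induction k)
    case 0
    then show ?case using borel_multifun_singleton by simp
  next
    case (Suc k)
    have "{w. (x, w) \<in> ?E ^^ Suc k} = (\<Union>z\<in>{z. (x, z) \<in> ?E ^^ k}. {w. rel_adj S z w})" for x by auto
    then show ?case using borel_multifun_comp[OF Suc adj] by simp
  qed
  moreover have "rel_ball S x n = (\<Union>k\<in>{..n}. {w. (x, w) \<in> ?E ^^ k})" for x
    by (auto simp: rel_ball_def)
  ultimately show ?thesis using borel_multifun_UN[of "{..n}" "\<lambda>k x. {w. (x, w) \<in> ?E ^^ k}"] by simp
qed

lemma finite_first_indices:
  assumes "finite (nbhd S x)"
  shows "finite (first_indices S x)" "set (nbr_list S x) = nbhd S x" "length (nbr_list S x) = gdeg S x"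
proof -
  have inj: "inj_on (\<lambda>i. snd (S i) x) (first_indices S x)"
    by (rule inj_onI) (metis (mono_tags, lifting) first_indices_def linorder_neqE_nat mem_Collect_eq)
  have im: "(\<lambda>i. snd (S i) x) ` first_indices S x = nbhd S x" (is "?l = ?r")
  proof
    show "?r \<subseteq> ?l"
    proof
      fix y assume "y \<in> nbhd S x"
      then have ex: "\<exists>i. x \<in> fst (S i) \<and> snd (S i) x = y" by (simp add: nbhd_def gedge_def)
      define i where "i = (LEAST i. x \<in> fst (S i) \<and> snd (S i) x = y)"
      have i: "x \<in> fst (S i)" "snd (S i) x = y" using LeastI_ex[OF ex] unfolding i_def by auto
      moreover have "\<not> (x \<in> fst (S j) \<and> snd (S j) x = y)" if "j < i" for j
        using not_less_Least that unfolding i_def by blast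
      ultimately have "i \<in> first_indices S x" by (auto simp: first_indices_def)
      then show "y \<in> ?l" using i by blast
    qed
  qed (auto simp: first_indices_def nbhd_def gedge_def)
  show fin: "finite (first_indices S x)" using assms inj im finite_image_iff by metis
  then show "set (nbr_list S x) = nbhd S x" using im by (simp add: nbr_list_def)
  show "length (nbr_list S x) = gdeg S x"
    using card_image[OF inj] im by (simp add: nbr_list_def gdeg_def)
qed

text \<open>Two arrows disagree at a point iff some separating set contains one value and not the
  other, so agreement is Borel. An index set is determined by countably many membership conditions,
  each comparing finitely many arrows.\<close>

lemma sets_first_indices:
  fixes S :: "nat \<Rightarrow> 'a::{second_countable_topology,t1_space} set \<times> ('a \<Rightarrow> 'a)"
  assumes S: "borel_arrow_seq S"
  shows "{x. first_indices S x = F} \<in> sets borel"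
proof -
  have U: "fst (S i) \<in> sets borel" and \<gamma>: "B \<in> sets borel \<Longrightarrow> fst (S i) \<inter> snd (S i) -` B \<in> sets borel" for i B
    using S by (auto simp: borel_arrow_seq_def borel_arrow_def)
  obtain \<B> :: "'a set set" where \<B>: "countable \<B>" "\<And>U. U \<in> \<B> \<Longrightarrow> U \<in> sets borel"
    "\<And>x F. finite F \<Longrightarrow> x \<notin> F \<Longrightarrow> \<exists>U\<in>\<B>. x \<in> U \<and> F \<inter> U = {}"
    using separating_basis by blast
  have eq: "{x \<in> fst (S i). x \<in> fst (S j) \<and> snd (S j) x = snd (S i) x} \<in> sets borel" for i j
  proof -
    have "{x \<in> fst (S i). x \<in> fst (S j) \<and> snd (S j) x = snd (S i) x} = (fst (S i) \<inter> fst (S j)) -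
        (\<Union>B\<in>\<B>. (fst (S i) \<inter> snd (S i) -` B) \<inter> (fst (S j) - (fst (S j) \<inter> snd (S j) -` B)))" (is "?l = ?r")
    proof
      show "?r \<subseteq> ?l"
      proof
        fix x assume x: "x \<in> ?r"
        have "snd (S j) x = snd (S i) x"
        proof (rule ccontr)
          assume "snd (S j) x \<noteq> snd (S i) x"
          then show False using \<B>(3)[of "{snd (S j) x}" "snd (S i) x"] x by auto
        qed
        then show "x \<in> ?l" using x by auto
      qed
    qed auto
    moreover have "(fst (S i) \<inter> snd (S i) -` B) \<inter> (fst (S j) - (fst (S j) \<inter> snd (S j) -` B)) \<in> sets borel"
      if "B \<in> \<B>" for B
      by (intro sets.Int[OF \<gamma>] sets.Diff U \<gamma> \<B>(2) that)
    then have "(\<Union>B\<in>\<B>. (fst (S i) \<inter> snd (S i) -` B) \<inter> (fst (S j) - (fst (S j) \<inter> snd (S j) -` B))) \<in> sets borel"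
      using \<B>(1) by (intro sets.countable_UN') auto
    ultimately show ?thesis using U by auto
  qed
  have mem: "{x. i \<in> first_indices S x} \<in> sets borel" for i
  proof -
    have "{x. i \<in> first_indices S x} = fst (S i) -
        (\<Union>j\<in>{..<i}. {x \<in> fst (S i). x \<in> fst (S j) \<and> snd (S j) x = snd (S i) x})"
      by (auto simp: first_indices_def)
    then show ?thesis using U eq by auto
  qed
  have "{x. i \<in> first_indices S x \<longleftrightarrow> i \<in> F} \<in> sets borel" for i
    using mem[of i] borel_comp[OF mem[of i]] by (cases "i \<in> F") (simp_all add: Collect_neg_eq)
  moreover have "{x. first_indices S x = F} = (\<Inter>i. {x. i \<in> first_indices S x \<longleftrightarrow> i \<in> F})" by auto
  ultimately show ?thesis by auto
qed

text \<open>On the Borel set where the index set is a given finite \<open>F\<close>, the neighbours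
  are values of fixed arrows, and there are only countably many finite \<open>F\<close>.\<close>

lemma sets_nbr_values:
  fixes S :: "nat \<Rightarrow> 'a::{second_countable_topology,t1_space} set \<times> ('a \<Rightarrow> 'a)" and f :: "'a \<Rightarrow> nat"
  assumes S: "borel_arrow_seq S" and fin: "\<And>x. finite (nbhd S x)" and f: "\<And>v. {x. f x = v} \<in> sets borel"
  shows "{x. map f (nbr_list S x) = v} \<in> sets borel"
proof -
  have \<gamma>: "B \<in> sets borel \<Longrightarrow> fst (S i) \<inter> snd (S i) -` B \<in> sets borel" for i B
    using S by (auto simp: borel_arrow_seq_def borel_arrow_def)
  have *: "{x. first_indices S x = F \<and> map (\<lambda>i. f (snd (S i) x)) xs = v} \<in> sets borel"
    if "set xs \<subseteq> F" for F xs v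
    using that
  proof (induction xs arbitrary: v)
    case Nil
    then show ?case using sets_first_indices[OF S, of F] by (cases "v = []") auto
  next
    case (Cons i xs)
    show ?case
    proof (cases v)
      case (Cons a v')
      have "{x. first_indices S x = F \<and> map (\<lambda>i. f (snd (S i) x)) (i # xs) = v} =
        (fst (S i) \<inter> snd (S i) -` {x. f x = a}) \<inter> {x. first_indices S x = F \<and> map (\<lambda>i. f (snd (S i) x)) xs = v'}"
        using Cons.prems by (auto simp: Cons first_indices_def)
      moreover have "set xs \<subseteq> F" using Cons.prems by simp
      ultimately show ?thesis using \<gamma>[OF f] Cons.IH by auto
    qed simp
  qed
  have "{x. map f (nbr_list S x) = v} = (\<Union>F\<in>Collect finite.
     {x. first_indices S x = F \<and> map (\<lambda>i. f (snd (S i) x)) (sorted_list_of_set F) = v})"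
    using finite_first_indices(1)[OF fin] by (auto simp: nbr_list_def comp_def)
  then show ?thesis
    using * by (auto intro!: sets.countable_UN' simp: countable_Collect_finite)
qed

text \<open>Members of \<open>R x\<close> are extensional, so the list of their values at the
  neighbours determines them.\<close>

lemma restrict_in_rule_iff:
  assumes "local_rule S b R" "finite (nbhd S x)"
  shows "restrict f (nbhd S x) \<in> R x \<longleftrightarrow> map f (nbr_list S x) \<in> rule_seqs S R x"
proof
  assume "restrict f (nbhd S x) \<in> R x"
  moreover have "map f (nbr_list S x) = map (restrict f (nbhd S x)) (nbr_list S x)"
    using finite_first_indices(2)[OF assms(2)] by simp
  ultimately show "map f (nbr_list S x) \<in> rule_seqs S R x" unfolding rule_seqs_def by blast
next
  assume "map f (nbr_list S x) \<in> rule_seqs S R x"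
  then obtain g where g: "g \<in> R x" "map f (nbr_list S x) = map g (nbr_list S x)"
    unfolding rule_seqs_def by blast
  then have "\<forall>y\<in>nbhd S x. f y = g y" using finite_first_indices(2)[OF assms(2)] by (metis map_eq_conv)
  moreover have "g \<in> extensional (nbhd S x)" using g(1) assms(1) by (auto simp: local_rule_def PiE_def)
  ultimately have "restrict f (nbhd S x) = g" by (auto simp: restrict_def extensional_def)
  then show "restrict f (nbhd S x) \<in> R x" using g by simp
qed

lemma sets_satisfied:
  fixes S :: "nat \<Rightarrow> 'a::{second_countable_topology,t1_space} set \<times> ('a \<Rightarrow> 'a)" and f :: "'a \<Rightarrow> nat"
  assumes S: "borel_arrow_seq S" and R: "local_rule S b R" "borel_rule S R"
    and fin: "\<And>x. finite (nbhd S x)" and deg: "\<And>x. gdeg S x \<le> d" and f: "\<And>v. {x. f x = v} \<in> sets borel"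
  shows "{x. restrict f (nbhd S x) \<in> R x} \<in> sets borel"
proof -
  \<comment> \<open>A Borel rule takes each single value of \<open>rule_seqs\<close> on a Borel set.
    The degree bound leaves finitely many possible values, all of them subsets of
    \<open>\<L>\<close>, so membership of one list is a finite union of such sets.\<close>
  define \<L> where "\<L> = {l. set l \<subseteq> {..<b} \<and> length l \<le> d}"
  have fin\<L>: "finite \<L>" unfolding \<L>_def by (rule finite_lists_length_le) simp
  have sub: "rule_seqs S R x \<subseteq> \<L>" for x
  proof -
    have "g y < b" if "g \<in> R x" "y \<in> nbhd S x" for g y
      using that R(1) by (auto simp: local_rule_def)
    then show ?thesis
      using finite_first_indices(2,3)[OF fin[of x]] deg[of x] by (auto simp: rule_seqs_def \<L>_def)
  qed
  have "{x. v \<in> rule_seqs S R x} = (\<Union>A\<in>{A. A \<subseteq> \<L> \<and> v \<in> A}. {x. rule_seqs S R x = A})" for v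
    using sub by auto
  then have mem: "{x. v \<in> rule_seqs S R x} \<in> sets borel" for v
    using R(2) fin\<L> by (auto simp: borel_rule_def intro!: sets.finite_UN)
  have "{x. restrict f (nbhd S x) \<in> R x} = (\<Union>v. {x. map f (nbr_list S x) = v} \<inter> {x. v \<in> rule_seqs S R x})"
    using restrict_in_rule_iff[OF R(1) fin] by auto
  then show ?thesis using mem sets_nbr_values[OF S fin f] by (auto intro!: sets.countable_UN')
qed

section \<open>Counting resampling histories\<close>

text \<open>Events that read disjoint blocks of coordinates are independent.\<close>
lemma card_disjoint_constraints:
  fixes e :: "'j \<Rightarrow> 'v \<Rightarrow> 'd" and F :: "'j \<Rightarrow> ('v \<Rightarrow> 'c) set" and p :: real
  assumes "finite J" "finite D" "finite V" "V \<noteq> {}" "0 \<le> p"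
    and "\<And>j. j \<in> J \<Longrightarrow> e j ` T j \<subseteq> D" "\<And>j. j \<in> J \<Longrightarrow> inj_on (e j) (T j)"
    and "disjoint_family_on (\<lambda>j. e j ` T j) J"
    and "\<And>j. j \<in> J \<Longrightarrow> F j \<subseteq> T j \<rightarrow>\<^sub>E V"
    and "\<And>j. j \<in> J \<Longrightarrow> real (card (F j)) \<le> p * real (card V) ^ card (T j)"
  shows "real (card {s \<in> D \<rightarrow>\<^sub>E V. \<forall>j\<in>J. (\<lambda>t\<in>T j. s (e j t)) \<in> F j}) \<le> p ^ card J * real (card V) ^ card D"
  using assms
proof (induction J arbitrary: D rule: finite_induct)
  case empty
  then show ?case by (simp add: card_PiE)
next
  case (insert j J)
  define D' where "D' = D - e j ` T j"
  define A where "A = {s \<in> D \<rightarrow>\<^sub>E V. \<forall>i\<in>insert j J. (\<lambda>t\<in>T i. s (e i t)) \<in> F i}"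
  define A' where "A' = {s \<in> D' \<rightarrow>\<^sub>E V. \<forall>i\<in>J. (\<lambda>t\<in>T i. s (e i t)) \<in> F i}"
  have sub: "e j ` T j \<subseteq> D" and "inj_on (e j) (T j)" and Fj: "F j \<subseteq> T j \<rightarrow>\<^sub>E V" using insert.prems by auto
  then have "card (e j ` T j) = card (T j)" by (simp add: card_image)
  then have cD: "card D = card (T j) + card D'"
    unfolding D'_def using sub \<open>finite D\<close> by (metis card_Diff_subset card_mono finite_subset le_add_diff_inverse)
  have finT: "finite (T j)" using sub \<open>finite D\<close> \<open>inj_on (e j) (T j)\<close> by (meson finite_imageD finite_subset)
  have disj: "e i ` T i \<inter> e j ` T j = {}" if "i \<in> J" for i
    using disjoint_family_onD[OF insert.prems(7), of i j] insert.hyps(2) that by auto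
  have IH: "real (card A') \<le> p ^ card J * real (card V) ^ card D'"
    unfolding A'_def
  proof (rule insert.IH)
    show "e i ` T i \<subseteq> D'" if "i \<in> J" for i
      using that insert.prems(5)[of i] disj[OF that] unfolding D'_def by auto
    show "disjoint_family_on (\<lambda>j. e j ` T j) J"
      using insert.prems(7) by (auto simp: disjoint_family_on_def)
  qed (use insert.prems in \<open>auto simp: D'_def\<close>)
  \<comment> \<open>A seed is determined by the block read by \<open>j\<close> and by its remaining
    coordinates; the first lies in \<open>F j\<close>, the second satisfies the constraints of
    \<open>J\<close>.\<close>
  define h where "h s = ((\<lambda>t\<in>T j. s (e j t)), restrict s D')" for s :: "'d \<Rightarrow> 'c"
  have "inj_on h A"
  proof (rule inj_onI)
    fix s s' assume s: "s \<in> A" "s' \<in> A" "h s = h s'"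
    show "s = s'"
    proof (rule PiE_ext[where k = D and s = "\<lambda>_. V"])
      fix d assume "d \<in> D"
      show "s d = s' d"
      proof (cases "d \<in> D'")
        case True
        have "restrict s D' d = restrict s' D' d" using s(3) unfolding h_def by simp
        then show ?thesis using True by simp
      next
        case False
        then obtain t where t: "t \<in> T j" "d = e j t" using \<open>d \<in> D\<close> unfolding D'_def by auto
        have "(\<lambda>t\<in>T j. s (e j t)) t = (\<lambda>t\<in>T j. s' (e j t)) t" using s(3) unfolding h_def by simp
        then show ?thesis using t by simp
      qed
    qed (use s in \<open>auto simp: A_def\<close>)
  qed
  moreover have "h ` A \<subseteq> F j \<times> A'"
  proof (rule image_subsetI)
    fix s assume s: "s \<in> A"
    have "restrict s D' \<in> D' \<rightarrow>\<^sub>E V" using s unfolding A_def D'_def by auto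
    moreover have "(\<lambda>t\<in>T i. restrict s D' (e i t)) \<in> F i" if "i \<in> J" for i
    proof -
      have "e i t \<in> D'" if "t \<in> T i" for t
        using that \<open>i \<in> J\<close> insert.prems(5)[of i] disj[of i] unfolding D'_def by auto
      then have "(\<lambda>t\<in>T i. restrict s D' (e i t)) = (\<lambda>t\<in>T i. s (e i t))" by auto
      then show ?thesis using s that unfolding A_def by auto
    qed
    ultimately show "h s \<in> F j \<times> A'" using s unfolding h_def A_def A'_def by auto
  qed
  moreover have "finite (F j)"
    using Fj finite_PiE[OF finT, of "\<lambda>_. V"] \<open>finite V\<close> finite_subset by blast
  moreover have "finite (D' \<rightarrow>\<^sub>E V)"
    using finite_PiE[of D' "\<lambda>_. V"] \<open>finite D\<close> \<open>finite V\<close> unfolding D'_def by blast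
  then have "finite A'" unfolding A'_def by simp
  ultimately have "card A \<le> card (F j) * card A'"
    by (metis card_cartesian_product card_inj_on_le finite_cartesian_product)
  then have "real (card A) \<le> real (card (F j)) * real (card A')"
    by (metis of_nat_le_iff of_nat_mult)
  also have "\<dots> \<le> (p * real (card V) ^ card (T j)) * (p ^ card J * real (card V) ^ card D')"
    using insert.prems IH by (intro mult_mono) auto
  also have "\<dots> = p ^ card (insert j J) * real (card V) ^ card D"
    using insert.hyps cD by (simp add: power_add)
  finally show ?case unfolding A_def .
qed

text \<open>Candidates for the first \<open>n + 1\<close> layers of a history, where
  \<open>G\<close> bounds a layer in terms of the previous one. Empty layers are allowed, so shorter
  histories are padded to this length.\<close>

primrec codes :: "('a set \<Rightarrow> 'a set) \<Rightarrow> nat \<Rightarrow> 'a set \<Rightarrow> 'a set list set" where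
  "codes G 0 I = {[I]}"
| "codes G (Suc n) I = (\<Union>J\<in>Pow (G I). (#) I ` codes G n J)"

lemma map_in_codes:
  assumes "\<And>l. I (Suc l) \<subseteq> G (I l)"
  shows "map I [l..<l + Suc n] \<in> codes G n (I l)"
proof (induction n arbitrary: l)
  case (Suc n)
  have "map I [l..<l + Suc (Suc n)] = I l # map I [Suc l..<Suc l + Suc n]"
    by (subst upt_conv_Cons) simp_all
  then show ?case using Suc[of "Suc l"] assms[of l] by (auto simp del: upt_Suc)
qed simp

lemma hd_codes: "w \<in> codes G n I \<Longrightarrow> w \<noteq> [] \<and> hd w = I"
  by (induction n arbitrary: I w) auto

lemma finite_codes: "(\<And>I. finite (G I)) \<Longrightarrow> finite (codes G n I)"
  by (induction n arbitrary: I) auto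

lemma sum_power_card_Pow:
  fixes y :: real
  assumes "finite A"
  shows "(\<Sum>J\<in>Pow A. y ^ card J) = (1 + y) ^ card A"
  using assms
proof (induction A rule: finite_induct)
  case (insert a A)
  have "inj_on (insert a) (Pow A)" using insert.hyps(2) by (auto simp: inj_on_def)
  then have "(\<Sum>J\<in>insert a ` Pow A. y ^ card J) = (\<Sum>J\<in>Pow A. y ^ card (insert a J))"
    by (simp add: sum.reindex)
  also have "\<dots> = (\<Sum>J\<in>Pow A. y * y ^ card J)"
    using insert.hyps by (intro sum.cong refl) (subst card_insert_disjoint, auto dest: finite_subset)
  finally have "(\<Sum>J\<in>insert a ` Pow A. y ^ card J) = y * (1 + y) ^ card A"
    by (simp add: insert.IH sum_distrib_left[symmetric])
  moreover have "Pow A \<inter> insert a ` Pow A = {}" using insert.hyps by auto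
  ultimately show ?case using insert
    by (simp add: Pow_insert sum.union_disjoint algebra_simps)
qed simp

text \<open>This is where the Lovasz condition enters: \<open>y\<close> is a supersolution of the branching recursion
  \<open>y = q (1 + y)^d\<close>. With \<open>q = 1 / (e d)\<close> one can take \<open>y = 1 / d\<close>.\<close>
lemma sum_weight_codes:
  fixes q y :: real
  assumes G: "\<And>I. finite (G I)" and d: "\<And>I. I \<subseteq> X \<Longrightarrow> G I \<subseteq> X \<and> card (G I) \<le> d * card I"
    and q: "0 \<le> q" "0 \<le> y" "q * (1 + y) ^ d \<le> y"
  shows "I \<subseteq> X \<Longrightarrow> (\<Sum>w\<in>codes G n I. q ^ (\<Sum>A\<leftarrow>w. card A)) \<le> y ^ card I"
proof (induction n arbitrary: I)
  case 0
  have "q * 1 \<le> q * (1 + y) ^ d" using q by (intro mult_left_mono) auto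
  then have "q \<le> y" using q by linarith
  then show ?case using q by (simp add: power_mono)
next
  case (Suc n)
  have "(\<Sum>w\<in>codes G (Suc n) I. q ^ (\<Sum>A\<leftarrow>w. card A))
      = (\<Sum>J\<in>Pow (G I). \<Sum>w\<in>(#) I ` codes G n J. q ^ (\<Sum>A\<leftarrow>w. card A))"
    unfolding codes.simps using G finite_codes[of G]
    by (intro sum.UNION_disjoint) (auto dest!: hd_codes)
  also have "\<dots> = (\<Sum>J\<in>Pow (G I). q ^ card I * (\<Sum>w\<in>codes G n J. q ^ (\<Sum>A\<leftarrow>w. card A)))"
    by (simp add: sum.reindex power_add sum_distrib_left)
  also have "\<dots> \<le> (\<Sum>J\<in>Pow (G I). q ^ card I * y ^ card J)"
    using Suc d[OF Suc.prems] q by (intro sum_mono mult_left_mono) auto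
  also have "\<dots> = q ^ card I * (1 + y) ^ card (G I)"
    using G by (simp add: sum_power_card_Pow sum_distrib_left[symmetric])
  also have "\<dots> \<le> q ^ card I * (1 + y) ^ (d * card I)"
    using q d[OF Suc.prems] by (intro mult_left_mono power_increasing) auto
  also have "\<dots> = (q * (1 + y) ^ d) ^ card I"
    by (simp add: power_mult_distrib power_mult)
  also have "\<dots> \<le> y ^ card I" using q by (intro power_mono) auto
  finally show ?case .
qed

text \<open>The resamplings of clauses in \<open>X\<close>, sorted into layers as in the Foata normal form of a trace:
  each resampling goes one layer above the highest earlier one that shares a variable with it.
  Hence the layers meeting a variable \<open>y\<close> list the resamplings of \<open>y\<close> in temporal order, and a clause in
  layer \<open>l\<close> was violated when \<open>y\<close> carried its seed entry number \<open>hits N I y l\<close>.\<close>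
definition layered :: "'x set \<Rightarrow> ('x \<Rightarrow> 'v set) \<Rightarrow> (nat \<Rightarrow> 'x set) \<Rightarrow> bool" where
  "layered X N I \<longleftrightarrow> (\<forall>l. I l \<subseteq> X \<and> I (Suc l) \<subseteq> {x \<in> X. \<exists>x'\<in>I l. N x \<inter> N x' \<noteq> {}} \<and>
     disjoint_family_on N (I l))"

definition hits :: "('x \<Rightarrow> 'v set) \<Rightarrow> (nat \<Rightarrow> 'x set) \<Rightarrow> 'v \<Rightarrow> nat \<Rightarrow> nat" where
  "hits N I y l = card {l'. l' < l \<and> (\<exists>x\<in>I l'. y \<in> N x)}"

text \<open>Here \<open>F x\<close> stands for the violating assignments. Testing is confined to
  \<open>W\<close> because in the application every clause sharing a variable with one in
  \<open>W\<close> lies in \<open>X\<close>, so the layers determine the entries that it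
  read.\<close>

definition consistent ::
  "('x \<Rightarrow> 'v set) \<Rightarrow> ('x \<Rightarrow> ('v \<Rightarrow> 'c) set) \<Rightarrow> 'x set \<Rightarrow> (nat \<Rightarrow> 'x set) \<Rightarrow> ('v \<times> nat \<Rightarrow> 'c) \<Rightarrow> bool" where
  "consistent N F W I s \<longleftrightarrow> (\<forall>l. \<forall>x\<in>I l \<inter> W. (\<lambda>y\<in>N x. s (y, hits N I y l)) \<in> F x)"

lemma hits_le: "hits N I y l \<le> l"
proof -
  have "hits N I y l \<le> card {..<l}" unfolding hits_def by (intro card_mono) auto
  then show ?thesis by simp
qed

text \<open>Layer \<open>l\<close> itself is counted at \<open>l'\<close> but not at
  \<open>l\<close>; hence two layers using the same variable read different seed entries of
  it.\<close>

lemma hits_less: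
  assumes "l < l'" "x \<in> I l" "y \<in> N x"
  shows "hits N I y l < hits N I y l'"
  unfolding hits_def using assms by (intro psubset_card_mono) auto

text \<open>Distinct pairs of a layer and a clause read disjoint blocks of the seed: clauses of one
  layer share no variable, and a variable met again in a later layer is read at a larger index. So
  the constraints are independent.\<close>

lemma card_consistent:
  fixes N :: "'x \<Rightarrow> 'v set" and p :: real and n :: nat
  assumes X: "finite X" and C: "finite C" "\<And>x. x \<in> X \<Longrightarrow> N x \<subseteq> C" and V: "finite V" "V \<noteq> {}"
    and p: "0 \<le> p" and W: "W \<subseteq> X" and F: "\<And>x. x \<in> W \<Longrightarrow> F x \<subseteq> N x \<rightarrow>\<^sub>E V"
    and Fp: "\<And>x. x \<in> W \<Longrightarrow> real (card (F x)) \<le> p * real (card V) ^ card (N x)"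
    and I: "layered X N I"
  defines "D \<equiv> C \<times> {..n}"
  shows "real (card {s \<in> D \<rightarrow>\<^sub>E V. consistent N F W I s})
    \<le> p ^ (\<Sum>l\<le>n. card (I l \<inter> W)) * real (card V) ^ card D"
proof -
  define J where "J = (SIGMA l:{..n}. I l \<inter> W)"
  define e where "e j y = (y, hits N I y (fst j))" for j :: "nat \<times> 'x" and y
  define T where "T j = N (snd j)" for j :: "nat \<times> 'x"
  have finIW: "finite (I l \<inter> W)" for l using W X by (meson finite_Int finite_subset)
  then have finJ: "finite J" by (simp add: J_def)
  have sub: "e j ` T j \<subseteq> D" if "j \<in> J" for j
    using that C(2) W le_trans[OF hits_le[of N I _ "fst j"]] by (auto simp: J_def D_def e_def T_def subset_eq)
  have inj: "inj_on (e j) (T j)" for j by (auto simp: inj_on_def e_def)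
  have disj: "disjoint_family_on (\<lambda>j. e j ` T j) J"
    unfolding disjoint_family_on_def
  proof (intro ballI impI)
    fix j j' assume j: "j \<in> J" "j' \<in> J" "j \<noteq> j'"
    obtain l x l' x' where eq: "j = (l, x)" "j' = (l', x')" by fastforce
    have x: "x \<in> I l" "x' \<in> I l'" using j eq by (auto simp: J_def)
    show "e j ` T j \<inter> e j' ` T j' = {}"
    proof (rule ccontr)
      assume "e j ` T j \<inter> e j' ` T j' \<noteq> {}"
      then obtain y where y: "y \<in> N x" "y \<in> N x'" "hits N I y l = hits N I y l'"
        unfolding e_def T_def eq by auto
      then have "l = l'"
        using hits_less[where I = I and N = N, OF _ x(1) y(1), of l'] hits_less[where I = I and N = N, OF _ x(2) y(2), of l]
        by (cases l l' rule: linorder_cases) auto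
      moreover have "disjoint_family_on N (I l)" using I by (auto simp: layered_def)
      ultimately have "x = x'" using x y unfolding disjoint_family_on_def by blast
      then show False using \<open>l = l'\<close> eq j by simp
    qed
  qed
  have "card {s \<in> D \<rightarrow>\<^sub>E V. consistent N F W I s} \<le> card {s \<in> D \<rightarrow>\<^sub>E V. \<forall>j\<in>J. (\<lambda>t\<in>T j. s (e j t)) \<in> F (snd j)}"
    using C V by (intro card_mono finite_subset[OF _ finite_PiE[of D "\<lambda>_. V"]])
      (auto simp: consistent_def J_def e_def T_def D_def)
  also have "real \<dots> \<le> p ^ card J * real (card V) ^ card D"
  proof (rule card_disjoint_constraints[OF finJ _ V p sub inj disj])
    show "finite D" using C by (simp add: D_def)
    have "snd j \<in> W" if "j \<in> J" for j using that by (auto simp: J_def)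
    then show "F (snd j) \<subseteq> T j \<rightarrow>\<^sub>E V" "real (card (F (snd j))) \<le> p * real (card V) ^ card (T j)" if "j \<in> J" for j
      using F Fp that unfolding T_def by blast+
  qed
  finally show ?thesis using finIW by (simp add: J_def card_SigmaI)
qed

text \<open>Union bound over histories. The inequality required of a history replaces its
  probability by \<open>\<eta>\<close> times its weight; the weights with first layer
  \<open>I0\<close> sum to at most \<open>y ^ card I0\<close>, and summing over \<open>I0\<close>
  gives \<open>(1 + y) ^ card X\<close>.\<close>

lemma card_consistent_with_some:
  fixes N :: "'x \<Rightarrow> 'v set" and p q y \<eta> :: real and n :: nat
  assumes X: "finite X" and C: "finite C" "\<And>x. x \<in> X \<Longrightarrow> N x \<subseteq> C" and V: "finite V" "V \<noteq> {}"
    and p: "0 \<le> p" and W: "W \<subseteq> X" and F: "\<And>x. x \<in> W \<Longrightarrow> F x \<subseteq> N x \<rightarrow>\<^sub>E V"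
    and Fp: "\<And>x. x \<in> W \<Longrightarrow> real (card (F x)) \<le> p * real (card V) ^ card (N x)"
    and d: "\<And>x. x \<in> X \<Longrightarrow> card {x' \<in> X. N x' \<inter> N x \<noteq> {}} \<le> d"
    and q: "0 \<le> q" "0 \<le> y" "q * (1 + y) ^ d \<le> y" and \<eta>: "0 \<le> \<eta>"
  defines "D \<equiv> C \<times> {..n}"
  shows "real (card {s \<in> D \<rightarrow>\<^sub>E V. \<exists>I. layered X N I \<and> (\<forall>l>n. I l = {}) \<and>
      p ^ (\<Sum>l\<le>n. card (I l \<inter> W)) \<le> \<eta> * q ^ (\<Sum>l\<le>n. card (I l)) \<and> consistent N F W I s})
    \<le> \<eta> * (1 + y) ^ card X * real (card V) ^ card D" (is "real (card ?Bad) \<le> _")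
proof -
  define G where "G I = {x \<in> X. \<exists>x'\<in>I. N x \<inter> N x' \<noteq> {}}" for I
  define lay where "lay w l = (if l < length w then w ! l else {})" for w :: "'x set list" and l
  define K where "K I0 = {w \<in> codes G n I0. layered X N (lay w) \<and>
    p ^ (\<Sum>l\<le>n. card (lay w l \<inter> W)) \<le> \<eta> * q ^ (\<Sum>A\<leftarrow>w. card A)}" for I0
  define E where "E w = {s \<in> D \<rightarrow>\<^sub>E V. consistent N F W (lay w) s}" for w
  have finG: "finite (G I)" for I using X by (simp add: G_def)
  then have finK: "finite (K I0)" for I0 using finite_codes[of G] by (simp add: K_def)
  have finD: "finite (D \<rightarrow>\<^sub>E V)" using C V by (auto simp: D_def intro: finite_PiE)
  have dG: "G I \<subseteq> X \<and> card (G I) \<le> d * card I" if "I \<subseteq> X" for I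
  proof -
    have "G I = (\<Union>x\<in>I. {x' \<in> X. N x' \<inter> N x \<noteq> {}})" using that by (auto simp: G_def)
    then have "card (G I) \<le> (\<Sum>x\<in>I. card {x' \<in> X. N x' \<inter> N x \<noteq> {}})"
      using card_UN_le[OF finite_subset[OF that X]] by simp
    also have "\<dots> \<le> (\<Sum>x\<in>I. d)" using that d by (intro sum_mono) auto
    finally show ?thesis by (auto simp: G_def mult.commute)
  qed
  have "?Bad \<subseteq> (\<Union>I0\<in>Pow X. \<Union>w\<in>K I0. E w)"
  proof
    fix s assume "s \<in> ?Bad"
    then obtain I where s: "s \<in> D \<rightarrow>\<^sub>E V" and I: "layered X N I" "\<And>l. l > n \<Longrightarrow> I l = {}"
      "p ^ (\<Sum>l\<le>n. card (I l \<inter> W)) \<le> \<eta> * q ^ (\<Sum>l\<le>n. card (I l))" "consistent N F W I s" by blast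
    define w where "w = map I [0..<Suc n]"
    have lay: "lay w = I"
    proof
      show "lay w l = I l" for l
        using I(2)[of l] by (auto simp: lay_def w_def simp del: upt_Suc)
    qed
    have "I (Suc l) \<subseteq> G (I l)" for l using I(1) by (auto simp: layered_def G_def)
    from map_in_codes[where I = I and G = G and l = 0 and n = n, OF this] have "w \<in> codes G n (I 0)" by (simp add: w_def)
    moreover have "(\<Sum>A\<leftarrow>w. card A) = (\<Sum>l\<le>n. card (I l))"
      by (simp add: w_def comp_def interv_sum_list_conv_sum_set_nat atLeast0LessThan lessThan_Suc_atMost del: upt_Suc)
    ultimately have "w \<in> K (I 0)" using I lay by (simp add: K_def)
    moreover have "I 0 \<in> Pow X" using I(1) by (auto simp: layered_def)
    moreover have "s \<in> E w" using s I lay by (simp add: E_def)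
    ultimately show "s \<in> (\<Union>I0\<in>Pow X. \<Union>w\<in>K I0. E w)" by blast
  qed
  then have "card ?Bad \<le> card (\<Union>I0\<in>Pow X. \<Union>w\<in>K I0. E w)"
    using finD by (intro card_mono finite_subset[OF _ finD]) (auto simp: E_def)
  also have "\<dots> \<le> (\<Sum>I0\<in>Pow X. card (\<Union>w\<in>K I0. E w))"
    using X by (intro card_UN_le) auto
  also have "\<dots> \<le> (\<Sum>I0\<in>Pow X. \<Sum>w\<in>K I0. card (E w))"
    using finK by (intro sum_mono card_UN_le) auto
  finally have "real (card ?Bad) \<le> (\<Sum>I0\<in>Pow X. \<Sum>w\<in>K I0. real (card (E w)))"
    by (metis (mono_tags, lifting) of_nat_le_iff of_nat_sum sum.cong)
  also have "\<dots> \<le> (\<Sum>I0\<in>Pow X. \<Sum>w\<in>K I0. \<eta> * real (card V) ^ card D * q ^ (\<Sum>A\<leftarrow>w. card A))"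
  proof (intro sum_mono)
    fix I0 w assume w: "w \<in> K I0"
    have "real (card (E w)) \<le> p ^ (\<Sum>l\<le>n. card (lay w l \<inter> W)) * real (card V) ^ card D"
      unfolding E_def D_def by (rule card_consistent) (use assms w in \<open>auto simp: K_def\<close>)
    also have "\<dots> \<le> (\<eta> * q ^ (\<Sum>A\<leftarrow>w. card A)) * real (card V) ^ card D"
      using w by (intro mult_right_mono) (auto simp: K_def)
    finally show "real (card (E w)) \<le> \<eta> * real (card V) ^ card D * q ^ (\<Sum>A\<leftarrow>w. card A)"
      by (simp add: mult_ac)
  qed
  also have "\<dots> \<le> (\<Sum>I0\<in>Pow X. \<Sum>w\<in>codes G n I0. \<eta> * real (card V) ^ card D * q ^ (\<Sum>A\<leftarrow>w. card A))"
    using finite_codes[of G] finG q \<eta> by (intro sum_mono sum_mono2) (auto simp: K_def)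
  also have "\<dots> = \<eta> * real (card V) ^ card D * (\<Sum>I0\<in>Pow X. \<Sum>w\<in>codes G n I0. q ^ (\<Sum>A\<leftarrow>w. card A))"
    by (simp add: sum_distrib_left)
  also have "\<dots> \<le> \<eta> * real (card V) ^ card D * (\<Sum>I0\<in>Pow X. y ^ card I0)"
    using sum_weight_codes[where G = G and X = X and d = d, OF finG dG q] \<eta>
    by (intro mult_left_mono sum_mono) auto
  finally show ?thesis using X by (simp add: sum_power_card_Pow mult_ac)
qed

section \<open>The resampling procedure\<close>

text \<open>The elements of \<open>N x\<close> are the variables of the clause \<open>x\<close>. At time \<open>t\<close> all violated clauses of
  colour \<open>t mod k\<close> are resampled, but none more than \<open>M\<close> times. The state counts the resamplings of each
  variable and of each clause; a variable of colour \<open>j\<close> resampled \<open>i\<close> times carries the value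
  \<open>s (j, i)\<close>, so that all variables of one colour share their randomness. The reduction modulo \<open>b\<close> only
  serves to give a value below \<open>b\<close> outside the domain of the seed.\<close>
locale resampling =
  fixes N :: "'a \<Rightarrow> 'a set" and R :: "'a \<Rightarrow> ('a \<Rightarrow> nat) set" and c :: "'a \<Rightarrow> nat"
    and k b M :: nat and s :: "nat \<times> nat \<Rightarrow> nat"
begin

definition entry :: "'a \<times> nat \<Rightarrow> nat" where
  "entry = (\<lambda>(y, i). s (c y, i) mod b)"

definition picked :: "nat \<Rightarrow> ('a \<Rightarrow> nat) \<times> ('a \<Rightarrow> nat) \<Rightarrow> 'a set" where
  "picked t st = {x. c x = t mod k \<and> snd st x < M \<and> (\<lambda>y\<in>N x. entry (y, fst st y)) \<notin> R x}"

primrec run :: "nat \<Rightarrow> ('a \<Rightarrow> nat) \<times> ('a \<Rightarrow> nat)" where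
  "run 0 = ((\<lambda>_. 0), (\<lambda>_. 0))"
| "run (Suc t) = ((\<lambda>y. fst (run t) y + of_bool (\<exists>x\<in>picked t (run t). y \<in> N x)),
                  (\<lambda>x. snd (run t) x + of_bool (x \<in> picked t (run t))))"

abbreviation "var_count t \<equiv> fst (run t)"
abbreviation "clause_count t \<equiv> snd (run t)"

lemma clause_count_le: "clause_count t x \<le> M"
  by (induction t) (auto simp: picked_def)

text \<open>Induction on time. One colour is active at a time and \<open>c\<close> is injective on
  \<open>X\<close>, so at most one clause of \<open>X\<close> is resampled; it is inserted one layer
  above the highest one that shares a variable with it.\<close>

lemma run_layered:
  assumes W: "W \<subseteq> X" and inj: "inj_on c X"
    and WX: "\<And>x y z. x \<in> W \<Longrightarrow> y \<in> N x \<Longrightarrow> y \<in> N z \<Longrightarrow> z \<in> X"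
    and ne: "\<And>x. N x = {} \<Longrightarrow> (\<lambda>_. undefined) \<in> R x"
  shows "\<exists>I. layered X N I \<and> finite {l. I l \<noteq> {}} \<and> (\<forall>x\<in>X. clause_count t x = card {l. x \<in> I l}) \<and>
    (\<forall>x\<in>W. \<forall>y\<in>N x. var_count t y = card {l. \<exists>z\<in>I l. y \<in> N z}) \<and>
    consistent N (\<lambda>x. - R x) W I entry"
proof (induction t)
  case 0
  show ?case
    by (rule exI[of _ "\<lambda>_. {}"]) (auto simp: layered_def consistent_def disjoint_family_on_def)
next
  case (Suc t)
  then obtain I where I: "layered X N I" "finite {l. I l \<noteq> {}}"
    and a: "\<And>x. x \<in> X \<Longrightarrow> clause_count t x = card {l. x \<in> I l}"
    and m: "\<And>x y. x \<in> W \<Longrightarrow> y \<in> N x \<Longrightarrow> var_count t y = card {l. \<exists>z\<in>I l. y \<in> N z}"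
    and con: "consistent N (\<lambda>x. - R x) W I entry"
    by blast
  have IX: "I l \<subseteq> X" and chain: "I (Suc l) \<subseteq> {x \<in> X. \<exists>x'\<in>I l. N x \<inter> N x' \<noteq> {}}"
    and disj: "disjoint_family_on N (I l)" for l using I(1) by (auto simp: layered_def)
  define V where "V = picked t (run t)"
  show ?case
  proof (cases "V \<inter> X = {}")
    case True
    have "clause_count (Suc t) x = card {l. x \<in> I l}" if "x \<in> X" for x
      using a[OF that] True that by (auto simp: V_def)
    \<comment> \<open>Clauses outside \<open>X\<close> may be resampled now, but by
      \<open>WX\<close> they share no variable with a clause of \<open>W\<close>.\<close>
    moreover have "var_count (Suc t) y = card {l. \<exists>z\<in>I l. y \<in> N z}" if "x \<in> W" "y \<in> N x" for x y
      using m[OF that] WX[OF that] True by (auto simp: V_def)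
    ultimately show ?thesis using I con by blast
  next
    case False
    then obtain z where z: "z \<in> V" "z \<in> X" by blast
    have uniq: "v = z" if "v \<in> V" "v \<in> X" for v
      using that z inj by (auto simp: V_def picked_def inj_on_def)
    have viol: "(\<lambda>y\<in>N z. entry (y, var_count t y)) \<notin> R z" using z(1) by (simp add: V_def picked_def)
    \<comment> \<open>A clause without variables is satisfied by \<open>ne\<close>. That
      \<open>N z\<close> is nonempty ensures later that \<open>z\<close> is not yet in layer
      \<open>L\<close>.\<close>
    then have Nz: "N z \<noteq> {}" using ne[of z] by (auto simp: restrict_def)
    \<comment> \<open>The clause \<open>z\<close> will go into the lowest layer \<open>L\<close>
      from which on nothing shares a variable with it. By minimality the layer just below
      \<open>L\<close>, if there is one, contains a clause that does.\<close>
    define P where "P l \<longleftrightarrow> (\<forall>l'\<ge>l. \<forall>x\<in>I l'. N x \<inter> N z = {})" for l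
    define L where "L = (LEAST l. P l)"
    obtain l0 where "\<forall>l\<in>{l. I l \<noteq> {}}. l < l0"
      using I(2) by (metis finite_nat_set_iff_bounded)
    then have "I l = {}" if "l \<ge> l0" for l using that by (auto simp: not_less[symmetric])
    then have "P l0" unfolding P_def by blast
    then have "P L" unfolding L_def by (rule LeastI)
    then have free: "N x \<inter> N z = {}" if "L \<le> l" "x \<in> I l" for l x
      using that unfolding P_def by blast
    have touch: "\<exists>x\<in>I l. N x \<inter> N z \<noteq> {}" if "L = Suc l" for l
    proof -
      have "\<not> P l" using that not_less_Least[of l P] unfolding L_def by auto
      then obtain l' x where "l' \<ge> l" "x \<in> I l'" "N x \<inter> N z \<noteq> {}" unfolding P_def by blast
      moreover then have "l' = l" using free[of l' x] that by (cases "l' = l") auto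
      ultimately show ?thesis by blast
    qed
    define I' where "I' = I(L := insert z (I L))"
    have I'L: "I' L = insert z (I L)" and I'other: "\<And>l. l \<noteq> L \<Longrightarrow> I' l = I l" and sub: "\<And>l. I l \<subseteq> I' l"
      by (auto simp: I'_def)
    have znot: "z \<notin> I L" using free[of L z] Nz by auto
    have "layered X N I'"
      unfolding layered_def
    proof (intro allI conjI)
      fix l
      show "I' l \<subseteq> X" using IX z(2) by (auto simp: I'_def)
      show "I' (Suc l) \<subseteq> {x \<in> X. \<exists>x'\<in>I' l. N x \<inter> N x' \<noteq> {}}"
      proof
        fix x assume "x \<in> I' (Suc l)"
        then consider "x \<in> I (Suc l)" | "x = z" "Suc l = L" by (auto simp: I'_def split: if_splits)
        then show "x \<in> {x \<in> X. \<exists>x'\<in>I' l. N x \<inter> N x' \<noteq> {}}"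
        proof cases
          case 1
          then show ?thesis using chain[of l] sub[of l] by blast
        next
          case 2
          then show ?thesis using touch[of l] sub[of l] z(2) by blast
        qed
      qed
      show "disjoint_family_on N (I' l)"
        using disj[of l] free[of L] by (auto simp: I'_def disjoint_family_on_def)
    qed
    moreover have "finite {l. I' l \<noteq> {}}"
      by (rule finite_subset[of _ "insert L {l. I l \<noteq> {}}"]) (use I(2) in \<open>auto simp: I'_def\<close>)
    moreover have "clause_count (Suc t) x = card {l. x \<in> I' l}" if "x \<in> X" for x
    proof (cases "x = z")
      case True
      have "{l. z \<in> I' l} = insert L {l. z \<in> I l}" by (auto simp: I'_def)
      moreover have "finite {l. z \<in> I l}" using I(2) by (auto elim: rev_finite_subset)
      ultimately show ?thesis using a[OF that] znot z(1) True by (simp add: V_def)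
    next
      case False
      then have "{l. x \<in> I' l} = {l. x \<in> I l}" by (auto simp: I'_def)
      then show ?thesis using a[OF that] False uniq[OF _ that] by (auto simp: V_def)
    qed
    moreover have "var_count (Suc t) y = card {l. \<exists>z\<in>I' l. y \<in> N z}" if xy: "x \<in> W" "y \<in> N x" for x y
    proof -
      \<comment> \<open>A picked clause containing \<open>y\<close> lies in \<open>X\<close>, since
        \<open>y\<close> belongs to a clause of \<open>W\<close>; so it is \<open>z\<close>.\<close>
      have V: "(\<exists>v\<in>V. y \<in> N v) \<longleftrightarrow> y \<in> N z" using z(1) uniq WX[OF xy] by blast
      show ?thesis
      proof (cases "y \<in> N z")
        case True
        have "{l. \<exists>z\<in>I' l. y \<in> N z} = insert L {l. \<exists>z\<in>I l. y \<in> N z}" using True by (auto simp: I'_def)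
        moreover have "\<not> (\<exists>z\<in>I L. y \<in> N z)" using free[of L] True by blast
        moreover have "finite {l. \<exists>z\<in>I l. y \<in> N z}" using I(2) by (auto elim: rev_finite_subset)
        ultimately show ?thesis using m[OF xy] V True by (simp add: V_def)
      next
        case False
        then have "{l. \<exists>z\<in>I' l. y \<in> N z} = {l. \<exists>z\<in>I l. y \<in> N z}" by (auto simp: I'_def)
        then show ?thesis using m[OF xy] V False by (simp add: V_def)
      qed
    qed
    moreover have "consistent N (\<lambda>x. - R x) W I' entry"
      unfolding consistent_def
    proof (intro allI ballI)
      fix l x assume x: "x \<in> I' l \<inter> W"
      then consider "x \<in> I l" | "x = z" "l = L" by (auto simp: I'_def split: if_splits)
      then show "(\<lambda>y\<in>N x. entry (y, hits N I' y l)) \<in> - R x"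
      proof cases
        case 1
        \<comment> \<open>Inserting \<open>z\<close> preserves the entries read before: clauses in
          layers up to \<open>L\<close> count only layers below \<open>L\<close>, and clauses above
          \<open>L\<close> share no variable with \<open>z\<close>.\<close>
        have "hits N I' y l = hits N I y l" if "y \<in> N x" for y
        proof (cases "l \<le> L")
          case True
          then show ?thesis unfolding hits_def I'_def by (intro arg_cong[where f = card]) auto
        next
          case False
          then have "y \<notin> N z" using free[of l x] 1 that by auto
          then show ?thesis unfolding hits_def I'_def by (intro arg_cong[where f = card]) auto
        qed
        then have "(\<lambda>y\<in>N x. entry (y, hits N I' y l)) = (\<lambda>y\<in>N x. entry (y, hits N I y l))" by auto
        then show ?thesis using con 1 x by (auto simp: consistent_def)
      next
        case 2
        \<comment> \<open>All earlier layers using a variable of \<open>z\<close> lie below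
          \<open>L\<close>, so \<open>hits\<close> counts every resampling of it so far.\<close>
        have "hits N I' y L = var_count t y" if "y \<in> N z" for y
        proof -
          have "{l'. l' < L \<and> (\<exists>x\<in>I' l'. y \<in> N x)} = {l. \<exists>z\<in>I l. y \<in> N z}"
            using free[where x = "_ :: 'a"] that by (auto simp: I'_def not_le[symmetric])
          then show ?thesis using m[of z y] x 2 that by (simp add: hits_def)
        qed
        then have "(\<lambda>y\<in>N z. entry (y, hits N I' y L)) = (\<lambda>y\<in>N z. entry (y, var_count t y))" by auto
        then show ?thesis using viol 2 by simp
      qed
    qed
    ultimately show ?thesis by blast
  qed
qed

end

section \<open>A seed that works for all patterns\<close>

lemma sum_card_layers:
  fixes I :: "nat \<Rightarrow> 'x set"
  assumes W: "finite W" and I: "\<And>l. l > n \<Longrightarrow> I l = {}"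
  shows "(\<Sum>l\<le>n. card (I l \<inter> W)) = (\<Sum>x\<in>W. card {l. x \<in> I l})"
proof -
  have "(\<Sum>l\<le>n. card {x\<in>W. x \<in> I l}) = (\<Sum>x\<in>W. card {l. x \<in> I l})"
  proof (rule sum_multicount_gen[where R = "\<lambda>l x. x \<in> I l"])
    have "l \<le> n" if "x \<in> I l" for x l using I[of l] that by (cases "l \<le> n") auto
    then have "{l \<in> {..n}. x \<in> I l} = {l. x \<in> I l}" for x by auto
    then show "\<forall>x\<in>W. card {l \<in> {..n}. x \<in> I l} = card {l. x \<in> I l}" by simp
  qed (use W in auto)
  moreover have "{x\<in>W. x \<in> I l} = I l \<inter> W" for l by blast
  ultimately show ?thesis by simp
qed

text \<open>Each clause above the bottom layer has one in the layer just below it, so the layers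
  below a nonempty one are nonempty. Hence there are at most as many layers as resamplings, which
  bounds the seed length needed.\<close>

lemma layer_less_size:
  assumes I: "layered X N I" "finite {l. I l \<noteq> {}}" and X: "finite X" and l: "I l \<noteq> {}"
  shows "l < (\<Sum>x\<in>X. card {l. x \<in> I l})"
proof -
  have down: "I l' \<noteq> {}" if "l' \<le> l" for l'
    using that l
  proof (induction rule: inc_induct)
    case (step m)
    moreover have "I (Suc m) \<subseteq> {x \<in> X. \<exists>x'\<in>I m. N x \<inter> N x' \<noteq> {}}" using I(1) by (simp add: layered_def)
    ultimately show ?case by auto
  qed
  have IX: "I l \<subseteq> X" for l using I(1) by (auto simp: layered_def)
  obtain n where n: "\<And>l. I l \<noteq> {} \<Longrightarrow> l < n"
    using I(2) by (auto simp: finite_nat_set_iff_bounded)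
  have "Suc l = (\<Sum>l'\<le>l. 1)" by simp
  also have "\<dots> \<le> (\<Sum>l'\<le>l. card (I l' \<inter> X))"
  proof (intro sum_mono)
    fix l' assume "l' \<in> {..l}"
    then have "I l' \<inter> X \<noteq> {}" using down[of l'] IX[of l'] by auto
    then show "1 \<le> card (I l' \<inter> X)" using X by (simp add: Suc_le_eq card_gt_0_iff)
  qed
  also have "\<dots> \<le> (\<Sum>l'\<le>n. card (I l' \<inter> X))"
    using n[OF l] by (intro sum_mono2) auto
  also have "\<dots> = (\<Sum>x\<in>X. card {l. x \<in> I l})"
    using n less_asym by (intro sum_card_layers X) blast
  finally show ?thesis by simp
qed

text \<open>The colouring is injective on the variables of \<open>X\<close>, so clauses share a
  variable iff their coloured copies do.\<close>

lemma layered_image: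
  assumes I: "layered X N I" and inj: "inj_on c X" and injN: "inj_on c (\<Union>(N ` X))"
    and N': "\<And>x. x \<in> X \<Longrightarrow> N' (c x) = c ` N x"
  shows "layered (c ` X) N' (\<lambda>l. c ` I l)"
proof -
  have IX: "I l \<subseteq> X" and chain: "I (Suc l) \<subseteq> {x \<in> X. \<exists>x'\<in>I l. N x \<inter> N x' \<noteq> {}}"
    and disj: "disjoint_family_on N (I l)" for l using I by (auto simp: layered_def)
  have cap: "c ` N x \<inter> c ` N x' = c ` (N x \<inter> N x')" if "x \<in> X" "x' \<in> X" for x x'
    using that by (intro inj_on_image_Int[OF injN, symmetric]) auto
  show ?thesis
    unfolding layered_def
  proof (intro allI conjI)
    fix l
    show "c ` I l \<subseteq> c ` X" using IX by blast
    show "c ` I (Suc l) \<subseteq> {\<alpha> \<in> c ` X. \<exists>\<beta>\<in>c ` I l. N' \<alpha> \<inter> N' \<beta> \<noteq> {}}"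
    proof (rule image_subsetI)
      fix x assume "x \<in> I (Suc l)"
      then obtain x' where x: "x \<in> X" "x' \<in> I l" "N x \<inter> N x' \<noteq> {}" using chain by blast
      then have "N' (c x) \<inter> N' (c x') \<noteq> {}" using IX[of l] by (auto simp: N' cap subset_eq)
      then show "c x \<in> {\<alpha> \<in> c ` X. \<exists>\<beta>\<in>c ` I l. N' \<alpha> \<inter> N' \<beta> \<noteq> {}}" using x by blast
    qed
    show "disjoint_family_on N' (c ` I l)"
      unfolding disjoint_family_on_def
    proof (intro ballI impI)
      fix \<alpha> \<beta> assume "\<alpha> \<in> c ` I l" "\<beta> \<in> c ` I l" "\<alpha> \<noteq> \<beta>"
      then obtain x x' where x: "x \<in> I l" "x' \<in> I l" "\<alpha> = c x" "\<beta> = c x'" "x \<noteq> x'" by blast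
      then have "N x \<inter> N x' = {}" using disj[of l] by (auto simp: disjoint_family_on_def)
      then show "N' \<alpha> \<inter> N' \<beta> = {}" using x IX[of l] by (simp add: N' cap subset_eq)
    qed
  qed
qed

lemma hits_image:
  assumes IX: "\<And>l. I l \<subseteq> X" and injN: "inj_on c (\<Union>(N ` X))"
    and N': "\<And>x. x \<in> X \<Longrightarrow> N' (c x) = c ` N x" and y: "y \<in> \<Union>(N ` X)"
  shows "hits N' (\<lambda>l. c ` I l) (c y) l = hits N I y l"
proof -
  have "(\<exists>\<alpha>\<in>c ` I l. c y \<in> N' \<alpha>) \<longleftrightarrow> (\<exists>x\<in>I l. y \<in> N x)" for l
  proof -
    have "c y \<in> N' (c x) \<longleftrightarrow> y \<in> N x" if "x \<in> I l" for x
    proof -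
      have "x \<in> X" using that IX by blast
      then show ?thesis using inj_on_image_mem_iff[OF injN y, of "N x"] N' by auto
    qed
    then show ?thesis by auto
  qed
  then show ?thesis by (simp add: hits_def)
qed

text \<open>The seed is indexed by colours, so a history and its coloured copy read the same
  entries. Their indices are at most \<open>n\<close>, inside the domain of the seed, where the
  values are below \<open>b\<close> and equal their residues.\<close>

lemma consistent_image:
  fixes s :: "'c \<times> nat \<Rightarrow> nat" and c :: "'a \<Rightarrow> 'c"
  assumes IX: "\<And>l. I l \<subseteq> X" and W: "W \<subseteq> X" and inj: "inj_on c X" and injN: "inj_on c (\<Union>(N ` X))"
    and N': "\<And>x. x \<in> X \<Longrightarrow> N' (c x) = c ` N x"
    and F': "\<And>x. x \<in> W \<Longrightarrow> F' (c x) = {h \<in> N' (c x) \<rightarrow>\<^sub>E {..<b}. (\<lambda>y\<in>N x. h (c y)) \<in> F x}"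
    and I: "\<And>l. l > n \<Longrightarrow> I l = {}"
    and s: "s \<in> C \<times> {..n} \<rightarrow>\<^sub>E {..<b}" and C: "c ` \<Union>(N ` X) \<subseteq> C"
    and con: "consistent N F W I (\<lambda>(y, i). s (c y, i) mod b)"
  shows "consistent N' F' (c ` W) (\<lambda>l. c ` I l) s"
  unfolding consistent_def
proof (intro allI ballI)
  fix l \<alpha> assume "\<alpha> \<in> c ` I l \<inter> c ` W"
  then obtain x x' where x: "x \<in> I l" "x' \<in> W" "\<alpha> = c x" "c x' = c x" by auto
  then have "x' = x" using inj_onD[OF inj] IX[of l] W by blast
  then have x: "x \<in> I l" "x \<in> W" "\<alpha> = c x" using x by auto
  then have "x \<in> X" and "l \<le> n" using W I[of l] by (blast, cases "l \<le> n") auto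
  define h where "h = (\<lambda>\<beta>\<in>N' \<alpha>. s (\<beta>, hits N' (\<lambda>l. c ` I l) \<beta> l))"
  have hit: "hits N' (\<lambda>l. c ` I l) (c y) l = hits N I y l" if "y \<in> N x" for y
    using \<open>x \<in> X\<close> that by (intro hits_image[OF IX injN N']) auto
  have range: "s (c y, hits N I y l) < b" if "y \<in> N x" for y
  proof -
    have "(c y, hits N I y l) \<in> C \<times> {..n}"
      using C \<open>x \<in> X\<close> that le_trans[OF hits_le \<open>l \<le> n\<close>] by auto
    then show ?thesis using s by (auto simp: PiE_iff)
  qed
  have "h \<in> N' \<alpha> \<rightarrow>\<^sub>E {..<b}"
    using range hit by (auto simp: h_def x(3) N'[OF \<open>x \<in> X\<close>])
  moreover have "h (c y) = s (c y, hits N I y l) mod b" if "y \<in> N x" for y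
  proof -
    have "c y \<in> N' \<alpha>" using that N'[OF \<open>x \<in> X\<close>] x(3) by blast
    then have "h (c y) = s (c y, hits N I y l)" by (simp add: h_def hit[OF that])
    then show ?thesis using range[OF that] by simp
  qed
  then have "(\<lambda>y\<in>N x. h (c y)) = (\<lambda>y\<in>N x. s (c y, hits N I y l) mod b)"
    by (rule restrict_ext)
  moreover have "(\<lambda>y\<in>N x. s (c y, hits N I y l) mod b) \<in> F x"
    using con x(1,2) unfolding consistent_def by simp
  ultimately have "h \<in> F' \<alpha>" using F'[OF x(2)] x(3) by simp
  then show "(\<lambda>\<beta>\<in>N' \<alpha>. s (\<beta>, hits N' (\<lambda>l. c ` I l) \<beta> l)) \<in> F' \<alpha>" unfolding h_def .
qed

text \<open>What a vertex sees of the graph and of the rule near it, with clauses and variables replaced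
  by their colours: clauses \<open>X\<close>, interior clauses \<open>W\<close>, the variables of each clause, and the value
  assignments violating it.\<close>
definition patterns ::
  "nat \<Rightarrow> nat \<Rightarrow> (nat set \<times> nat set \<times> (nat \<Rightarrow> nat set) \<times> (nat \<Rightarrow> (nat \<Rightarrow> nat) set)) set" where
  "patterns k b = Pow {..<k} \<times> Pow {..<k} \<times> ({..<k} \<rightarrow>\<^sub>E Pow {..<k}) \<times>
     ({..<k} \<rightarrow>\<^sub>E Pow (\<Union>A\<in>Pow {..<k}. A \<rightarrow>\<^sub>E {..<b}))"

lemma finite_patterns: "finite (patterns k b)"
proof -
  have "finite (A \<rightarrow>\<^sub>E {..<b})" if "A \<in> Pow {..<k}" for A
    using that by (intro finite_PiE) (auto dest: finite_subset)
  then have "finite (\<Union>A\<in>Pow {..<k}. A \<rightarrow>\<^sub>E {..<b})" by blast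
  then show ?thesis unfolding patterns_def
    by (intro finite_cartesian_product finite_PiE) simp_all
qed

definition admissible where
  "admissible p d b = (\<lambda>(X, W, N, F). W \<subseteq> X \<and>
     (\<forall>x\<in>W. F x \<subseteq> N x \<rightarrow>\<^sub>E {..<b::nat} \<and> real (card (F x)) \<le> p * real b ^ card (N x)) \<and>
     (\<forall>x\<in>X. card {x' \<in> X. N x' \<inter> N x \<noteq> {}} \<le> d))"

text \<open>The constant \<open>\<eta>\<close> must not depend on the length \<open>n\<close> of the seed, since \<open>n\<close> is chosen
  after \<open>\<eta>\<close>; this is possible because the set of patterns does not depend on \<open>n\<close>.\<close>
lemma good_seed_exists:
  fixes p q y :: real
  assumes p: "0 \<le> p" and q: "0 \<le> q" "0 \<le> y" "q * (1 + y) ^ d \<le> y" and b: "0 < b"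
  obtains \<eta> :: real where "\<eta> > 0"
    "\<forall>n. \<exists>s\<in>{..<k} \<times> {..n} \<rightarrow>\<^sub>E {..<b}. \<forall>X W N F. (X, W, N, F) \<in> patterns k b \<longrightarrow> admissible p d b (X, W, N, F) \<longrightarrow>
      \<not> (\<exists>I. layered X N I \<and> (\<forall>l>n. I l = {}) \<and>
         p ^ (\<Sum>l\<le>n. card (I l \<inter> W)) \<le> \<eta> * q ^ (\<Sum>l\<le>n. card (I l)) \<and> consistent N F W I s)"
proof -
  \<comment> \<open>Up to the factor \<open>\<eta>\<close>, \<open>K\<close> bounds the proportion
    of bad seeds: one term for each pattern, whose \<open>X\<close> has at most \<open>k\<close>
    colours. The \<open>+ 1\<close> in \<open>\<eta>\<close> makes the proportion strictly less than
    1.\<close>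
  define K where "K = real (card (patterns k b)) * (1 + y) ^ k"
  define \<eta> where "\<eta> = 1 / (K + 1)"
  have "K \<ge> 0" using q by (simp add: K_def)
  then have \<eta>: "\<eta> > 0" "\<eta> * K < 1" by (auto simp: \<eta>_def divide_simps)
  show ?thesis
  proof (rule that[OF \<eta>(1)], rule allI)
    fix n :: nat
    define D where "D = {..<k} \<times> {..n}"
    define Bad where "Bad = (\<lambda>(X :: nat set, W, N, F). {s \<in> D \<rightarrow>\<^sub>E {..<b}. \<exists>I. layered X N I \<and> (\<forall>l>n. I l = {}) \<and>
         p ^ (\<Sum>l\<le>n. card (I l \<inter> W)) \<le> \<eta> * q ^ (\<Sum>l\<le>n. card (I l)) \<and> consistent N F W I s})"
    define A where "A = {\<tau> \<in> patterns k b. admissible p d b \<tau>}"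
    have finA: "finite A" using finite_patterns by (simp add: A_def)
    have finD: "finite (D \<rightarrow>\<^sub>E {..<b})" by (auto simp: D_def intro: finite_PiE)
    have cD: "real (card (D \<rightarrow>\<^sub>E {..<b})) = real b ^ card D" by (simp add: card_PiE D_def)
    have Bad: "real (card (Bad \<tau>)) \<le> \<eta> * (1 + y) ^ k * real b ^ card D" if "\<tau> \<in> A" for \<tau>
    proof -
      obtain X W N F where \<tau>: "\<tau> = (X, W, N, F)" by (cases \<tau>) auto
      have N: "N x \<subseteq> {..<k}" if "x \<in> X" for x
        using that \<open>\<tau> \<in> A\<close> by (auto simp: \<tau> A_def patterns_def PiE_iff)
      have adm: "admissible p d b (X, W, N, F)" using \<open>\<tau> \<in> A\<close> by (simp add: A_def \<tau>)
      have "X \<subseteq> {..<k}" using \<open>\<tau> \<in> A\<close> by (auto simp: \<tau> A_def patterns_def)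
      then have "finite X" "card X \<le> k" using finite_subset card_mono[of "{..<k}" X] by auto
      have "real (card (Bad \<tau>)) \<le> \<eta> * (1 + y) ^ card X * real (card {..<b}) ^ card ({..<k} \<times> {..n})"
        unfolding Bad_def \<tau> D_def prod.case
      proof (rule card_consistent_with_some[where d = d])
        show "{..<b} \<noteq> {}" using b by (simp add: lessThan_empty_iff)
        show "W \<subseteq> X" using adm by (simp add: admissible_def)
        show "F x \<subseteq> N x \<rightarrow>\<^sub>E {..<b}" if "x \<in> W" for x using adm that by (simp add: admissible_def)
        show "real (card (F x)) \<le> p * real (card {..<b}) ^ card (N x)" if "x \<in> W" for x
          using adm that by (simp add: admissible_def)
        show "card {x' \<in> X. N x' \<inter> N x \<noteq> {}} \<le> d" if "x \<in> X" for x
          using adm that by (simp add: admissible_def)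
      qed (use \<open>finite X\<close> N p q \<eta>(1) in simp_all)
      also have "\<dots> = \<eta> * (1 + y) ^ card X * real b ^ card D" by (simp add: D_def)
      also have "\<dots> \<le> \<eta> * (1 + y) ^ k * real b ^ card D"
        using q \<eta>(1) \<open>card X \<le> k\<close> by (intro mult_right_mono mult_left_mono power_increasing) auto
      finally show ?thesis .
    qed
    have "real (card (\<Union>\<tau>\<in>A. Bad \<tau>)) \<le> real (\<Sum>\<tau>\<in>A. card (Bad \<tau>))"
      using card_UN_le[OF finA] of_nat_mono by blast
    also have "\<dots> \<le> (\<Sum>\<tau>\<in>A. \<eta> * (1 + y) ^ k * real b ^ card D)"
      using Bad by (simp only: of_nat_sum) (rule sum_mono)
    also have "\<dots> = real (card A) * (\<eta> * (1 + y) ^ k * real b ^ card D)" by simp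
    also have "\<dots> \<le> real (card (patterns k b)) * (\<eta> * (1 + y) ^ k * real b ^ card D)"
      using q \<eta>(1) finite_patterns by (intro mult_right_mono) (auto simp: A_def intro: card_mono)
    also have "\<dots> = (\<eta> * K) * real b ^ card D" by (simp add: K_def)
    also have "\<dots> < 1 * real b ^ card D" using \<eta>(2) b by (intro mult_strict_right_mono) auto
    also have "\<dots> = real (card (D \<rightarrow>\<^sub>E {..<b}))" using cD by simp
    finally have "card (\<Union>\<tau>\<in>A. Bad \<tau>) < card (D \<rightarrow>\<^sub>E {..<b})" by simp
    then have "\<not> (D \<rightarrow>\<^sub>E {..<b} \<subseteq> (\<Union>\<tau>\<in>A. Bad \<tau>))"
    proof -
      have "finite (Bad \<tau>)" for \<tau> using finD by (cases \<tau>) (simp add: Bad_def)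
      then show ?thesis using \<open>card (\<Union>\<tau>\<in>A. Bad \<tau>) < _\<close> finA card_mono[of "\<Union>\<tau>\<in>A. Bad \<tau>" "D \<rightarrow>\<^sub>E {..<b}"] by auto
    qed
    then obtain s where s: "s \<in> D \<rightarrow>\<^sub>E {..<b}" "\<And>\<tau>. \<tau> \<in> A \<Longrightarrow> s \<notin> Bad \<tau>" by blast
    show "\<exists>s\<in>{..<k} \<times> {..n} \<rightarrow>\<^sub>E {..<b}. \<forall>X W N F. (X, W, N, F) \<in> patterns k b \<longrightarrow> admissible p d b (X, W, N, F) \<longrightarrow>
      \<not> (\<exists>I. layered X N I \<and> (\<forall>l>n. I l = {}) \<and>
         p ^ (\<Sum>l\<le>n. card (I l \<inter> W)) \<le> \<eta> * q ^ (\<Sum>l\<le>n. card (I l)) \<and> consistent N F W I s)"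
    proof (intro bexI[of _ s] allI impI)
      fix X W N F
      assume "(X, W, N, F) \<in> patterns k b" "admissible p d b (X, W, N, F)"
      then have "s \<notin> Bad (X, W, N, F)" by (intro s(2)) (simp add: A_def)
      then show "\<not> (\<exists>I. layered X N I \<and> (\<forall>l>n. I l = {}) \<and>
         p ^ (\<Sum>l\<le>n. card (I l \<inter> W)) \<le> \<eta> * q ^ (\<Sum>l\<le>n. card (I l)) \<and> consistent N F W I s)"
        using s(1) by (simp add: Bad_def)
    qed (use s(1) in \<open>simp add: D_def\<close>)
  qed
qed

context resampling
begin

text \<open>Connects an actual run with the finitely many patterns over which the union bound is
  taken: the history near a vertex is copied to colours without changing the numbers of
  resamplings.\<close>

lemma pattern_of_run:
  assumes W: "W \<subseteq> X" and X: "finite X" and inj: "inj_on c X" and injN: "inj_on c (\<Union>(N ` X))"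
    and WX: "\<And>x y z. x \<in> W \<Longrightarrow> y \<in> N x \<Longrightarrow> y \<in> N z \<Longrightarrow> z \<in> X"
    and ne: "\<And>x. N x = {} \<Longrightarrow> (\<lambda>_. undefined) \<in> R x"
    and c: "\<And>x. c x < k" and finN: "\<And>x. finite (N x)"
    and p: "\<And>x. real (card ((N x \<rightarrow>\<^sub>E {..<b}) - R x)) \<le> p * real b ^ card (N x)"
    and d: "\<And>x. x \<in> X \<Longrightarrow> card {x' \<in> X. N x' \<inter> N x \<noteq> {}} \<le> d"
    and s: "s \<in> {..<k} \<times> {..M * k} \<rightarrow>\<^sub>E {..<b}"
  obtains X' W' N' F' I where "(X', W', N', F') \<in> patterns k b" "admissible p d b (X', W', N', F')"
    "layered X' N' I" "\<And>l. l > M * k \<Longrightarrow> I l = {}" "consistent N' F' W' I s"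
    "(\<Sum>l\<le>M * k. card (I l \<inter> W')) = (\<Sum>x\<in>W. clause_count t x)"
    "(\<Sum>l\<le>M * k. card (I l)) = (\<Sum>x\<in>X. clause_count t x)"
proof -
  have "\<exists>I. layered X N I \<and> finite {l. I l \<noteq> {}} \<and> (\<forall>x\<in>X. clause_count t x = card {l. x \<in> I l}) \<and>
    (\<forall>x\<in>W. \<forall>y\<in>N x. var_count t y = card {l. \<exists>z\<in>I l. y \<in> N z}) \<and>
    consistent N (\<lambda>x. - R x) W I entry"
    using W inj WX ne by (rule run_layered)
  then obtain I where I: "layered X N I" "finite {l. I l \<noteq> {}}"
    and a: "\<And>x. x \<in> X \<Longrightarrow> clause_count t x = card {l. x \<in> I l}"
    and con: "consistent N (\<lambda>x. - R x) W I entry"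
    by blast
  have IX: "I l \<subseteq> X" for l using I(1) by (simp add: layered_def)
  have "card X = card (c ` X)" using inj by (simp add: card_image)
  also have "\<dots> \<le> card {..<k}" using c by (intro card_mono) auto
  finally have "card X \<le> k" by simp
  \<comment> \<open>The seed length \<open>M * k\<close> comes from here: at most \<open>k\<close>
    clauses, as their colours differ, each resampled at most \<open>M\<close> times.\<close>
  have "(\<Sum>x\<in>X. card {l. x \<in> I l}) = (\<Sum>x\<in>X. clause_count t x)" using a by simp
  also have "\<dots> \<le> (\<Sum>x\<in>X. M)" using clause_count_le by (intro sum_mono)
  also have "\<dots> \<le> M * k" using \<open>card X \<le> k\<close> by simp
  finally have late: "I l = {}" if "l > M * k" for l
    using layer_less_size[OF I X, of l] that by (cases "I l = {}") auto
  \<comment> \<open>Within \<open>X\<close> the map \<open>g\<close> recovers a vertex from its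
    colour. Colours that do not occur are assigned empty sets below, so that the pattern consists of
    total functions on \<open>{..<k}\<close>.\<close>
  define g where "g = the_inv_into X c"
  have g: "g (c x) = x" if "x \<in> X" for x using the_inv_into_f_f[OF inj that] by (simp add: g_def)
  define N' where "N' = (\<lambda>\<alpha>\<in>{..<k}. if \<alpha> \<in> c ` X then c ` N (g \<alpha>) else {})"
  define F' where "F' = (\<lambda>\<alpha>\<in>{..<k}. if \<alpha> \<in> c ` W then
    {h \<in> N' \<alpha> \<rightarrow>\<^sub>E {..<b}. (\<lambda>y\<in>N (g \<alpha>). h (c y)) \<in> - R (g \<alpha>)} else {})"
  have N': "N' (c x) = c ` N x" if "x \<in> X" for x using that c g by (simp add: N'_def)
  have F': "F' (c x) = {h \<in> N' (c x) \<rightarrow>\<^sub>E {..<b}. (\<lambda>y\<in>N x. h (c y)) \<in> - R x}" if "x \<in> W" for x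
    using that c g[of x] W by (auto simp: F'_def)
  \<comment> \<open>Pulling back along the colouring is injective, so a coloured clause has no more
    violating assignments than the original.\<close>
  have cardF: "card (F' (c x)) \<le> card ((N x \<rightarrow>\<^sub>E {..<b}) - R x)" if "x \<in> W" for x
  proof (rule card_inj_on_le)
    have xX: "x \<in> X" using W that by blast
    show "finite ((N x \<rightarrow>\<^sub>E {..<b}) - R x)" using finN[of x] by (intro finite_Diff finite_PiE) auto
    show "inj_on (\<lambda>h. \<lambda>y\<in>N x. h (c y)) (F' (c x))"
    proof (rule inj_onI)
      fix h h' assume h: "h \<in> F' (c x)" "h' \<in> F' (c x)" "(\<lambda>y\<in>N x. h (c y)) = (\<lambda>y\<in>N x. h' (c y))"
      show "h = h'"
      proof (rule PiE_ext[where k = "N' (c x)" and s = "\<lambda>_. {..<b}"])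
        fix \<beta> assume "\<beta> \<in> N' (c x)"
        then obtain y where "y \<in> N x" "\<beta> = c y" using N'[OF xX] by blast
        then show "h \<beta> = h' \<beta>" using fun_cong[OF h(3), of y] by simp
      qed (use h F'[OF that] in auto)
    qed
    show "(\<lambda>h. \<lambda>y\<in>N x. h (c y)) ` F' (c x) \<subseteq> (N x \<rightarrow>\<^sub>E {..<b}) - R x"
      unfolding F'[OF that] N'[OF xX] by auto
  qed
  have cardN: "card (N' (c x)) = card (N x)" if "x \<in> X" for x
    using N'[OF that] card_image[OF inj_on_subset[OF injN UN_upper[OF that]]] by simp
  show thesis
  proof (rule that)
    show "(c ` X, c ` W, N', F') \<in> patterns k b"
    proof -
      have N'k: "N' \<alpha> \<subseteq> {..<k}" if "\<alpha> < k" for \<alpha> using c that by (auto simp: N'_def)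
      have "F' \<alpha> \<subseteq> (\<Union>A\<in>Pow {..<k}. A \<rightarrow>\<^sub>E {..<b})" if "\<alpha> < k" for \<alpha>
        using N'k[OF that] that by (auto simp: F'_def)
      moreover have "N' \<in> {..<k} \<rightarrow>\<^sub>E Pow {..<k}"
        using N'k by (intro PiE_I) (auto simp: N'_def)
      moreover have "c ` X \<subseteq> {..<k}" "c ` W \<subseteq> {..<k}" using c by auto
      ultimately show ?thesis unfolding patterns_def
        by (intro SigmaI PiE_I) (auto simp: F'_def)
    qed
    show "admissible p d b (c ` X, c ` W, N', F')"
      unfolding admissible_def prod.case
    proof (intro conjI ballI)
      show "c ` W \<subseteq> c ` X" using W by blast
      fix \<alpha> assume "\<alpha> \<in> c ` W"
      then obtain x where x: "x \<in> W" "x \<in> X" "\<alpha> = c x" using W by blast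
      show "F' \<alpha> \<subseteq> N' \<alpha> \<rightarrow>\<^sub>E {..<b}" using F'[OF x(1)] x(3) by auto
      have "real (card (F' \<alpha>)) \<le> real (card ((N x \<rightarrow>\<^sub>E {..<b}) - R x))" using cardF[OF x(1)] x(3) by simp
      then show "real (card (F' \<alpha>)) \<le> p * real b ^ card (N' \<alpha>)"
        using p[of x] cardN[OF x(2)] x(3) by simp
    next
      fix \<alpha> assume "\<alpha> \<in> c ` X"
      then obtain x where x: "x \<in> X" "\<alpha> = c x" by blast
      have "N' (c x') \<inter> N' (c x) = c ` (N x' \<inter> N x)" if "x' \<in> X" for x'
        unfolding N'[OF that] N'[OF x(1)] using that x(1) by (intro inj_on_image_Int[OF injN, symmetric]) auto
      then have "{\<beta> \<in> c ` X. N' \<beta> \<inter> N' \<alpha> \<noteq> {}} \<subseteq> c ` {x' \<in> X. N x' \<inter> N x \<noteq> {}}" using x(2) by auto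
      then have "card {\<beta> \<in> c ` X. N' \<beta> \<inter> N' \<alpha> \<noteq> {}} \<le> card {x' \<in> X. N x' \<inter> N x \<noteq> {}}"
        using X by (intro surj_card_le) auto
      then show "card {\<beta> \<in> c ` X. N' \<beta> \<inter> N' \<alpha> \<noteq> {}} \<le> d" using d[OF x(1)] by simp
    qed
    show "layered (c ` X) N' (\<lambda>l. c ` I l)" by (rule layered_image[OF I(1) inj injN N'])
    show "c ` I l = {}" if "l > M * k" for l using late[OF that] by simp
    show "consistent N' F' (c ` W) (\<lambda>l. c ` I l) s"
    proof (rule consistent_image[OF IX W inj injN N' F' late s])
      show "c ` \<Union>(N ` X) \<subseteq> {..<k}" using c by auto
      show "consistent N (\<lambda>x. - R x) W I (\<lambda>(y, i). s (c y, i) mod b)" using con by (simp add: entry_def)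
    qed
    have "c ` I l \<inter> c ` W = c ` (I l \<inter> W)" for l
      using IX W by (intro inj_on_image_Int[OF inj, symmetric])
    then have "card (c ` I l \<inter> c ` W) = card (I l \<inter> W)" for l
      using inj_on_subset[OF inj, of "I l \<inter> W"] W by (simp add: card_image le_infI2)
    then show "(\<Sum>l\<le>M * k. card (c ` I l \<inter> c ` W)) = (\<Sum>x\<in>W. clause_count t x)"
      using sum_card_layers[OF finite_subset[OF W X], of "M * k" I] late a W by (simp add: subset_eq)
    have "card (c ` I l) = card (I l \<inter> X)" for l
      using inj_on_subset[OF inj IX[of l]] IX[of l] by (simp add: card_image Int_absorb2)
    then show "(\<Sum>l\<le>M * k. card (c ` I l)) = (\<Sum>x\<in>X. clause_count t x)"
      using sum_card_layers[OF X, of "M * k" I] late a by simp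
  qed
qed

end

section \<open>The limit of the procedure\<close>

lemma mono_bounded_eventually_const:
  fixes g :: "nat \<Rightarrow> nat"
  assumes mono: "\<And>t. g t \<le> g (Suc t)" and bound: "\<And>t. g t \<le> B"
  obtains T where "\<And>t. T \<le> t \<Longrightarrow> g t = g T"
proof -
  have fin: "finite (range g)" using bound by (auto simp: finite_nat_set_iff_bounded_le)
  then have "Max (range g) \<in> range g" by (intro Max_in) auto
  then obtain T where T: "Max (range g) = g T" by blast
  have "g t = g T" if "T \<le> t" for t
    using lift_Suc_mono_le[of g, OF mono that] Max_ge[OF fin, of "g t"] T by simp
  then show thesis by (rule that)
qed

context resampling
begin

text \<open>Counts only increase, so where they are bounded this maximum is the eventual
  value.\<close>

definition limit_count :: "'a \<Rightarrow> nat" where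
  "limit_count y = Max (range (\<lambda>t. var_count t y))"

text \<open>By symmetry the clauses containing \<open>y\<close> are the elements of
  \<open>N y\<close>, and each change of \<open>y\<close> is due to at least one of them. With the
  cap \<open>M\<close> this bounds the count of \<open>y\<close>.\<close>

lemma var_count_le:
  assumes "finite (N y)" and sym: "\<And>x y. y \<in> N x \<Longrightarrow> x \<in> N y"
  shows "var_count t y \<le> (\<Sum>x\<in>N y. clause_count t x)"
proof (induction t)
  case (Suc t)
  have "of_bool (\<exists>x\<in>picked t (run t). y \<in> N x) \<le> (\<Sum>x\<in>N y. of_bool (x \<in> picked t (run t)) :: nat)"
  proof (cases "\<exists>x\<in>picked t (run t). y \<in> N x")
    case True
    then obtain x where x: "x \<in> picked t (run t)" "x \<in> N y" using sym by blast
    then show ?thesis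
      using member_le_sum[of x "N y" "\<lambda>x. of_bool (x \<in> picked t (run t)) :: nat"] assms(1) by simp
  qed simp
  then show ?case using Suc by (simp add: sum.distrib)
qed simp

lemma var_count_limit:
  assumes "finite (N y)" "\<And>x y. y \<in> N x \<Longrightarrow> x \<in> N y"
  obtains T where "\<And>t. T \<le> t \<Longrightarrow> var_count t y = limit_count y"
proof -
  have bound: "var_count t y \<le> (\<Sum>x\<in>N y. M)" for t
    using var_count_le[OF assms, of t] sum_mono[of "N y" "clause_count t" "\<lambda>_. M"] clause_count_le
    by (meson order_trans)
  have mono: "var_count t y \<le> var_count (Suc t) y" for t by simp
  obtain T where T: "\<And>t. T \<le> t \<Longrightarrow> var_count t y = var_count T y"
    using mono_bounded_eventually_const[of "\<lambda>t. var_count t y", OF mono bound] by blast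
  have fin: "finite (range (\<lambda>t. var_count t y))" using bound by (auto simp: finite_nat_set_iff_bounded_le)
  have "var_count t y \<le> var_count T y" for t
    using lift_Suc_mono_le[of "\<lambda>t. var_count t y" t "max t T", OF mono] T[of "max t T"] by simp
  then have "limit_count y = var_count T y"
    unfolding limit_count_def by (intro Max_eqI fin) auto
  then have "var_count t y = limit_count y" if "T \<le> t" for t using T[OF that] by simp
  then show thesis by (rule that)
qed

text \<open>If \<open>x\<close> were violated in the limit, it would be violated at a late time of
  its own colour, when its variables have their final values. Being below the cap it would be
  resampled, although its count has stabilised.\<close>

lemma limit_satisfies:
  assumes fin: "\<And>x. finite (N x)" and sym: "\<And>x y. y \<in> N x \<Longrightarrow> x \<in> N y"
    and less: "\<And>t x. clause_count t x < M" and c: "\<And>x. c x < k"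
  shows "(\<lambda>y\<in>N x. entry (y, limit_count y)) \<in> R x"
proof (rule ccontr)
  assume viol: "(\<lambda>y\<in>N x. entry (y, limit_count y)) \<notin> R x"
  have "\<exists>T. \<forall>t\<ge>T. var_count t y = limit_count y" for y
    using var_count_limit[OF fin sym, of y] by metis
  then obtain T where T: "\<And>y t. T y \<le> t \<Longrightarrow> var_count t y = limit_count y" by metis
  have "clause_count t x \<le> M" for t using less[of t x] by simp
  then obtain T' where T': "\<And>t. T' \<le> t \<Longrightarrow> clause_count t x = clause_count T' x"
    using mono_bounded_eventually_const[of "\<lambda>t. clause_count t x" M] by auto
  \<comment> \<open>A time with residue \<open>c x\<close> modulo \<open>k\<close> that is no
    earlier than any of the stabilisation times involved.\<close>
  define t where "t = c x + k * (Max (insert T' (T ` N x)))"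
  have k: "0 < k" using c[of x] by simp
  then have t: "t \<ge> Max (insert T' (T ` N x))" unfolding t_def
    by (metis Suc_leI mult.left_neutral mult_le_mono1 trans_le_add2 One_nat_def)
  then have "T' \<le> t" and "\<And>y. y \<in> N x \<Longrightarrow> T y \<le> t" using fin[of x] by auto
  then have "(\<lambda>y\<in>N x. entry (y, var_count t y)) = (\<lambda>y\<in>N x. entry (y, limit_count y))"
    using T by auto
  moreover have "c x = t mod k" using c[of x] by (simp add: t_def)
  ultimately have "x \<in> picked t (run t)" using viol less by (simp add: picked_def)
  then have "clause_count (Suc t) x = Suc (clause_count t x)" by simp
  then show False using T'[of t] T'[of "Suc t"] \<open>T' \<le> t\<close> by simp
qed

end

locale borel_resampling = resampling N R c k b M s
  for N :: "'a::topological_space \<Rightarrow> 'a set" and R c k b M s +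
  assumes N: "borel_multifun N" and symN: "\<And>x y. y \<in> N x \<Longrightarrow> x \<in> N y"
    and borel_color: "\<And>j. {x. c x = j} \<in> sets borel"
    and borel_satisfied: "\<And>f :: 'a \<Rightarrow> nat. (\<And>v. {x. f x = v} \<in> sets borel) \<Longrightarrow> {x. restrict f (N x) \<in> R x} \<in> sets borel"
begin

lemma borel_entry:
  assumes "\<And>i. {y. m y = i} \<in> sets borel"
  shows "{y. entry (y, m y) = v} \<in> sets borel"
proof -
  have "{y. entry (y, m y) = v} = (\<Union>(j, i)\<in>{(j, i). s (j, i) mod b = v}. {y. c y = j} \<inter> {y. m y = i})"
    by (auto simp: entry_def)
  also have "\<dots> \<in> sets borel"
    using assms borel_color by (intro sets.countable_UN') (auto intro: countableI_type)
  finally show ?thesis .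
qed

lemma borel_run:
  "(\<forall>i. {y. var_count t y = i} \<in> sets borel) \<and> (\<forall>i. {x. clause_count t x = i} \<in> sets borel)"
proof (induction t)
  case 0
  show ?case by auto
next
  case (Suc t)
  define V where "V = picked t (run t)"
  have "V = {x. c x = t mod k} \<inter> (\<Union>a\<in>{..<M}. {x. clause_count t x = a}) -
      {x. restrict (\<lambda>y. entry (y, var_count t y)) (N x) \<in> R x}"
    by (auto simp: V_def picked_def)
  moreover have "{x. restrict (\<lambda>y. entry (y, var_count t y)) (N x) \<in> R x} \<in> sets borel"
    using Suc by (intro borel_satisfied borel_entry) blast
  ultimately have V: "V \<in> sets borel" using borel_color Suc by auto
  \<comment> \<open>By symmetry of \<open>N\<close> these are the variables of the resampled
    clauses.\<close>
  define B where "B = {y. N y \<inter> V \<noteq> {}}"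
  have B: "B \<in> sets borel" unfolding B_def by (rule borel_multifunD[OF N V])
  have step: "{x. g x + of_bool (x \<in> A) = i} \<in> sets borel"
    if A: "A \<in> sets borel" and g: "\<And>i. {x. g x = i} \<in> sets borel" for g :: "'a \<Rightarrow> nat" and A i
  proof -
    have "{x. g x + of_bool (x \<in> A) = i} = ({x. g x = i} - A) \<union> (\<Union>j\<in>{j. Suc j = i}. {x. g x = j} \<inter> A)"
      by auto
    then show ?thesis using A g by (auto intro!: sets.countable_UN')
  qed
  have "(\<exists>x\<in>V. y \<in> N x) \<longleftrightarrow> y \<in> B" for y using symN by (auto simp: B_def)
  then have "{y. var_count (Suc t) y = i} \<in> sets borel" for i
    using step[OF B, of "var_count t" i] Suc by (simp add: V_def)
  moreover have "{x. clause_count (Suc t) x = i} \<in> sets borel" for i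
    using step[OF V, of "clause_count t" i] Suc by (simp add: V_def)
  ultimately show ?case by blast
qed

lemma borel_limit:
  assumes fin: "\<And>x. finite (N x)"
  shows "{y. entry (y, limit_count y) = v} \<in> sets borel"
proof (rule borel_entry)
  fix i
  \<comment> \<open>Eventual constancy expresses the limit by countable unions and intersections
    over time.\<close>
  have "limit_count y = i \<longleftrightarrow> (\<exists>T. \<forall>t. T \<le> t \<longrightarrow> var_count t y = i)" for y
  proof -
    obtain T where T: "\<And>t. T \<le> t \<Longrightarrow> var_count t y = limit_count y"
      using var_count_limit[OF fin symN] by blast
    show ?thesis
    proof
      assume "\<exists>T. \<forall>t. T \<le> t \<longrightarrow> var_count t y = i"
      then obtain T' where "\<And>t. T' \<le> t \<Longrightarrow> var_count t y = i" by blast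
      then show "limit_count y = i" using T[of "max T T'"] by simp
    qed (use T in blast)
  qed
  then have "{y. limit_count y = i} = (\<Union>T. \<Inter>t\<in>{T..}. {y. var_count t y = i})" by auto
  also have "\<dots> \<in> sets borel"
    using borel_run by (intro sets.countable_UN' sets.countable_INT'') auto
  finally show "{y. limit_count y = i} \<in> sets borel" .
qed

end

section \<open>Balls in the graph Rel(G)\<close>

lemma rel_adj_sym: "rel_adj S x y \<Longrightarrow> rel_adj S y x"
  by (auto simp: rel_adj_def)

lemma rel_ball_0: "rel_ball S x 0 = {x}"
  by (auto simp: rel_ball_def)

lemma rel_ball_mono: "m \<le> n \<Longrightarrow> rel_ball S x m \<subseteq> rel_ball S x n"
  unfolding rel_ball_def using le_trans by blast

lemma rel_ball_trans:
  assumes "y \<in> rel_ball S x m" "z \<in> rel_ball S y n"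
  shows "z \<in> rel_ball S x (m + n)"
proof -
  let ?E = "{(x, y). rel_adj S x y}"
  obtain i j where ij: "i \<le> m" "(x, y) \<in> ?E ^^ i" "j \<le> n" "(y, z) \<in> ?E ^^ j"
    using assms by (auto simp: rel_ball_def)
  then have "(x, z) \<in> ?E ^^ (i + j)" by (auto simp: relpow_add)
  moreover have "i + j \<le> m + n" using ij by simp
  ultimately show ?thesis unfolding rel_ball_def by blast
qed

lemma rel_adj_in_ball: "rel_adj S x y \<Longrightarrow> y \<in> rel_ball S x (Suc 0)"
  unfolding rel_ball_def by (auto intro!: exI[of _ "Suc 0"])

lemma rel_ball_Suc: "y \<in> rel_ball S x n \<Longrightarrow> rel_adj S y z \<Longrightarrow> z \<in> rel_ball S x (Suc n)"
  using rel_ball_trans[OF _ rel_adj_in_ball] by fastforce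

lemma rel_ball_sym:
  assumes "y \<in> rel_ball S x n"
  shows "x \<in> rel_ball S y n"
proof -
  let ?E = "{(x, y). rel_adj S x y}"
  have "(x, y) \<in> ?E ^^ i \<Longrightarrow> (y, x) \<in> ?E ^^ i" for i
  proof (induction i arbitrary: y)
    case (Suc i)
    then obtain z where "(x, z) \<in> ?E ^^ i" "rel_adj S z y" by auto
    then have "(y, z) \<in> ?E" "(z, x) \<in> ?E ^^ i" using Suc.IH rel_adj_sym by auto
    then show ?case by (rule relpow_Suc_I2)
  qed auto
  then show ?thesis using assms unfolding rel_ball_def by blast
qed

text \<open>Common neighbours of consecutive clauses on a path in Rel(G) themselves form a path in
  Rel(G), since two consecutive ones share the clause between them; the two end points add one
  step.\<close>

lemma nbhd_in_rel_ball:
  assumes sym: "symmetric_graph S" and "v \<in> rel_ball S u n" "y \<in> nbhd S u" "y' \<in> nbhd S v"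
  shows "y' \<in> rel_ball S y (Suc n)"
proof -
  let ?E = "{(x, y). rel_adj S x y}"
  have swap: "y \<in> nbhd S x \<longleftrightarrow> x \<in> nbhd S y" for x y using sym by (auto simp: symmetric_graph_def nbhd_def)
  have "(u, v) \<in> ?E ^^ i \<Longrightarrow> y' \<in> nbhd S v \<Longrightarrow> (y, y') \<in> ?E ^^ Suc i" for i
  proof (induction i arbitrary: v y')
    case 0
    then show ?case using assms(3) swap by (auto simp: rel_adj_def)
  next
    case (Suc i)
    then obtain w where w: "(u, w) \<in> ?E ^^ i" "rel_adj S w v" by auto
    then obtain z where z: "z \<in> nbhd S w" "z \<in> nbhd S v" by (auto simp: rel_adj_def)
    then have "(y, z) \<in> ?E ^^ Suc i" using Suc.IH[OF w(1)] by blast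
    moreover have "(z, y') \<in> ?E" using z Suc.prems(2) swap by (auto simp: rel_adj_def)
    ultimately show ?case by (metis relpow_Suc_I)
  qed
  moreover obtain i where "i \<le> n" "(u, v) \<in> ?E ^^ i" using assms(2) by (auto simp: rel_ball_def)
  ultimately have "Suc i \<le> Suc n" "(y, y') \<in> ?E ^^ Suc i" using assms(4) by auto
  then show ?thesis unfolding rel_ball_def by blast
qed

text \<open>Otherwise \<open>r + 1\<close> steps, each with growth factor above
  \<open>1 + \<epsilon>\<close>, would lead from \<open>M\<close> beyond \<open>M * B\<close>. The
  radius bound \<open>r\<close> does not involve \<open>M\<close>, which keeps the set of patterns
  independent of \<open>M\<close>.\<close>

lemma small_boundary:
  fixes A :: "nat \<Rightarrow> nat" and \<epsilon> B :: real
  assumes mono: "\<And>j. A j \<le> A (Suc j)" and A0: "A 0 = M" "0 < M" and \<epsilon>: "0 < \<epsilon>"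
    and AB: "real (A (Suc r)) \<le> M * B" "B < (1 + \<epsilon>) ^ Suc r"
  obtains j where "j \<le> r" "real (A (Suc j)) \<le> (1 + \<epsilon>) * A j" "M \<le> A j"
proof -
  have "\<exists>j\<le>r. real (A (Suc j)) \<le> (1 + \<epsilon>) * A j"
  proof (rule ccontr)
    assume neg: "\<not> ?thesis"
    have "(1 + \<epsilon>) ^ j * M \<le> A j" if "j \<le> Suc r" for j
      using that
    proof (induction j)
      case (Suc j)
      have "(1 + \<epsilon>) ^ Suc j * M = (1 + \<epsilon>) * ((1 + \<epsilon>) ^ j * M)" by simp
      also have "\<dots> \<le> (1 + \<epsilon>) * A j" using Suc \<epsilon> by (intro mult_left_mono) auto
      also have "\<dots> \<le> A (Suc j)" using neg Suc.prems by auto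
      finally show ?case .
    qed (use A0 in simp)
    then have "(1 + \<epsilon>) ^ Suc r * M \<le> M * B" using AB(1) by (meson order.refl order_trans)
    then have "(1 + \<epsilon>) ^ Suc r \<le> B" using A0(2) by (simp add: mult.commute)
    then show False using AB(2) by simp
  qed
  moreover have "M \<le> A j" for j using lift_Suc_mono_le[of A 0 j, OF mono] A0 by simp
  ultimately show thesis using that by blast
qed

text \<open>The gap between \<open>p\<close> and \<open>q\<close> pays twice: for small
  \<open>\<epsilon>\<close> the power \<open>q powr (1 + \<epsilon>)\<close> is close to
  \<open>q\<close>, which absorbs the boundary resamplings, and a factor \<open>\<theta>\<close>
  remains for each of the at least \<open>M\<close> inner ones.\<close>

lemma boundary_exponent:
  fixes p q :: real
  assumes "0 \<le> p" "p < q" "q < 1"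
  obtains \<epsilon> \<theta> :: real where "0 < \<epsilon>" "0 < \<theta>" "\<theta> < 1"
    "\<And>M w v :: nat. M \<le> w \<Longrightarrow> real v \<le> (1 + \<epsilon>) * w \<Longrightarrow> p ^ w \<le> \<theta> ^ M * q ^ v"
proof -
  have q: "0 < q" using assms by simp
  obtain \<theta> where \<theta>: "p / q < \<theta>" "\<theta> < 1" using dense[of "p / q" 1] assms by auto
  have "0 \<le> p / q" using assms by simp
  then have "0 < \<theta>" using \<theta> by linarith
  have "((\<lambda>\<epsilon>. \<theta> * q powr (1 + \<epsilon>)) \<longlongrightarrow> \<theta> * q powr (1 + 0)) (at_right 0)"
    using q by (intro tendsto_intros) auto
  moreover have "p < \<theta> * q powr (1 + 0)" using \<theta>(1) q by (simp add: divide_simps mult.commute)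
  ultimately have "\<forall>\<^sub>F \<epsilon> in at_right 0. p < \<theta> * q powr (1 + \<epsilon>)" by (rule order_tendstoD)
  then obtain b where b: "0 < b" "\<And>\<epsilon>. 0 < \<epsilon> \<Longrightarrow> \<epsilon> < b \<Longrightarrow> p < \<theta> * q powr (1 + \<epsilon>)"
    unfolding eventually_at_right_field by blast
  define \<epsilon> where "\<epsilon> = b / 2"
  have \<epsilon>: "0 < \<epsilon>" "p \<le> \<theta> * q powr (1 + \<epsilon>)" using b by (auto simp: \<epsilon>_def intro: less_imp_le)
  show thesis
  proof (rule that[OF \<epsilon>(1) \<open>0 < \<theta>\<close> \<theta>(2)])
    fix M w v :: nat assume w: "M \<le> w" and v: "real v \<le> (1 + \<epsilon>) * w"
    have "p ^ w \<le> (\<theta> * q powr (1 + \<epsilon>)) ^ w" using assms(1) \<epsilon>(2) by (rule power_mono[rotated])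
    also have "\<dots> = \<theta> ^ w * q powr ((1 + \<epsilon>) * w)"
      using q by (simp add: power_mult_distrib powr_powr[symmetric] powr_realpow)
    also have "\<dots> \<le> \<theta> ^ M * q powr v"
      using \<open>0 < \<theta>\<close> \<theta>(2) w v q assms(3) by (intro mult_mono power_decreasing powr_mono') auto
    finally show "p ^ w \<le> \<theta> ^ M * q ^ v" using q by (simp add: powr_realpow)
  qed
qed

section \<open>The Borel local lemma\<close>

theorem theorem1p3:
  fixes S :: "nat \<Rightarrow> ('a::polish_space) set \<times> ('a \<Rightarrow> 'a)"
    and b :: nat
    and R :: "'a \<Rightarrow> ('a \<Rightarrow> nat) set"
    and \<Delta> :: nat
  assumes "b \<ge> 2"
    and "borel_arrow_seq S"
    and "symmetric_graph S"
    and "local_rule S b R"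
    and "borel_rule S R"
    and "rel_unif_subexp_growth S"
    and "\<forall>x. rel_deg S x \<le> \<Delta>" and "\<exists>x. rel_deg S x = \<Delta>"
    and "\<forall>x. 1 - real (card (R x)) / real b ^ gdeg S x < 1 / (exp 1 * real \<Delta>)"
  shows "\<exists>f :: 'a \<Rightarrow> nat. f \<in> borel_measurable borel \<and> (\<forall>x. f x < b) \<and> satisfies_rule S R f"
proof -
  let ?N = "nbhd S"
  note S = assms(2) and symS = assms(3) and local = assms(4) and \<Delta>_max = assms(7)
  have swap: "x \<in> ?N y" if "y \<in> ?N x" for x y
    using symS that by (auto simp: symmetric_graph_def nbhd_def)
  \<comment> \<open>Growth is controlled beyond some radius only; smaller balls are finite as
    subsets.\<close>
  obtain r0 where r0: "\<And>n v. n > r0 \<Longrightarrow> finite (rel_ball S v n)"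
    using assms(6) unfolding rel_unif_subexp_growth_def by (metis zero_less_one)
  have fin_ball: "finite (rel_ball S v n)" for v n
    by (rule finite_subset[OF rel_ball_mono r0, of n "max n (Suc r0)"]) auto
  have "{y. rel_adj S x y} \<subseteq> rel_ball S x (Suc 0)" for x
    by (auto intro: rel_adj_in_ball)
  then have fin_adj: "finite {y. rel_adj S x y}" for x using fin_ball finite_subset by blast
  \<comment> \<open>Any two neighbours of \<open>x\<close> have \<open>x\<close> as a common
    neighbour, so \<open>?N x\<close> lies in the Rel(G)-neighbourhood of each of its
    members.\<close>
  have deg: "finite (?N x) \<and> card (?N x) \<le> \<Delta>" for x
  proof (cases "?N x = {}")
    case False
    then obtain y where y: "y \<in> ?N x" by blast
    have sub: "?N x \<subseteq> {z. rel_adj S y z}"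
      using swap[OF y] by (auto simp: rel_adj_def dest: swap)
    then have "card (?N x) \<le> rel_deg S y" unfolding rel_deg_def by (rule card_mono[OF fin_adj])
    then show ?thesis using sub fin_adj \<Delta>_max finite_subset le_trans by blast
  qed simp
  have finN: "finite (?N x)" for x using deg by blast

  \<comment> \<open>Violation probabilities and their uniform bound\<close>
  define viol where "viol x = 1 - real (card (R x)) / real b ^ gdeg S x" for x
  have Rsub: "R x \<subseteq> ?N x \<rightarrow>\<^sub>E {..<b}" for x using local by (simp add: local_rule_def)
  have finE: "finite (?N x \<rightarrow>\<^sub>E {..<b})" for x using finN[of x] by (intro finite_PiE) auto
  have cardE: "card (?N x \<rightarrow>\<^sub>E {..<b}) = b ^ gdeg S x" for x using finN[of x] by (simp add: card_PiE gdeg_def)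
  have cardR: "card (R x) \<le> b ^ gdeg S x" for x using card_mono[OF finE Rsub] cardE by simp
  have bpos: "0 < real b ^ n" for n using assms(1) by simp
  have viol_nonneg: "0 \<le> viol x" for x
  proof -
    have "real (card (R x)) \<le> real b ^ gdeg S x" using cardR[of x] by (metis of_nat_le_iff of_nat_power)
    then show ?thesis using bpos[of "gdeg S x"] by (simp add: viol_def)
  qed
  define q where "q = 1 / (exp 1 * real \<Delta>)"
  have viol_less: "viol x < q" for x using assms(9) by (simp add: viol_def q_def)
  have "0 < q" using viol_nonneg viol_less le_less_trans by blast
  \<comment> \<open>For \<open>\<Delta> = 0\<close> the quotient defining \<open>q\<close> would be
    0 by the convention on division.\<close>
  then have "0 < \<Delta>" by (cases "\<Delta> = 0") (auto simp: q_def)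
  have "1 < exp (1::real)" by simp
  moreover have "exp 1 * 1 \<le> exp 1 * real \<Delta>" using \<open>0 < \<Delta>\<close> by (intro mult_left_mono) auto
  ultimately have "1 < exp 1 * real \<Delta>" by linarith
  then have "q < 1" by (simp add: q_def)
  \<comment> \<open>With this \<open>y\<close> the supersolution inequality amounts to
    \<open>(1 + 1 / \<Delta>) ^ \<Delta> \<le> exp 1\<close>; this is where the constant e of the
    hypothesis is used.\<close>
  define y where "y = 1 / real \<Delta>"
  have "(1 + y) ^ \<Delta> \<le> exp 1"
    using exp_ge_one_plus_x_over_n_power_n[of \<Delta> 1] \<open>0 < \<Delta>\<close> by (simp add: y_def)
  then have "q * (1 + y) ^ \<Delta> \<le> q * exp 1" using \<open>0 < q\<close> by (intro mult_left_mono) auto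
  also have "q * exp 1 = y" by (simp add: q_def y_def)
  finally have y: "0 \<le> y" "q * (1 + y) ^ \<Delta> \<le> y" by (simp_all add: y_def)
  \<comment> \<open>An empty neighbourhood has a single assignment, and an empty rule there would
    have violation probability 1.\<close>
  have isolated: "(\<lambda>_. undefined) \<in> R x" if "?N x = {}" for x
  proof (rule ccontr)
    assume "(\<lambda>_. undefined) \<notin> R x"
    then have "R x = {}" using Rsub[of x] that by auto
    then show False using viol_less[of x] \<open>q < 1\<close> by (simp add: viol_def)
  qed

  \<comment> \<open>The hypothesis is strict only vertex by vertex. Bounded degrees leave finitely
    many values of \<open>viol\<close>, so their maximum \<open>p\<close> is still below
    \<open>q\<close>.\<close>
  have "range viol \<subseteq> (\<lambda>(i, d). 1 - real i / real b ^ d) ` ({..b ^ \<Delta>} \<times> {..\<Delta>})"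
  proof (rule image_subsetI)
    fix x
    have "gdeg S x \<le> \<Delta>" using deg by (simp add: gdeg_def)
    moreover have "b ^ gdeg S x \<le> b ^ \<Delta>" using \<open>gdeg S x \<le> \<Delta>\<close> assms(1) by (intro power_increasing) auto
    then have "card (R x) \<le> b ^ \<Delta>" using cardR[of x] by simp
    ultimately show "viol x \<in> (\<lambda>(i, d). 1 - real i / real b ^ d) ` ({..b ^ \<Delta>} \<times> {..\<Delta>})"
      by (intro image_eqI[of _ _ "(card (R x), gdeg S x)"]) (auto simp: viol_def)
  qed
  then have fin_viol: "finite (range viol)" by (rule finite_subset) auto
  define p where "p = Max (range viol)"
  have "viol x \<le> p" for x using fin_viol by (simp add: p_def)
  have "p \<in> range viol" unfolding p_def using fin_viol by (intro Max_in) auto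
  then have p: "0 \<le> p" "p < q" using viol_nonneg viol_less by auto
  have forbidden: "real (card ((?N x \<rightarrow>\<^sub>E {..<b}) - R x)) \<le> p * real b ^ card (?N x)" for x
  proof -
    have "real (card ((?N x \<rightarrow>\<^sub>E {..<b}) - R x)) = real b ^ gdeg S x - real (card (R x))"
      using card_Diff_subset[OF finite_subset[OF Rsub finE] Rsub, of x] cardE[of x] cardR[of x]
      by (simp add: of_nat_diff)
    also have "\<dots> = viol x * real b ^ gdeg S x" using assms(1) by (simp add: viol_def field_simps)
    also have "\<dots> \<le> p * real b ^ gdeg S x"
      using \<open>viol x \<le> p\<close> bpos[of "gdeg S x"] by (intro mult_right_mono) auto
    finally show ?thesis by (simp add: gdeg_def)
  qed

  \<comment> \<open>Constants and the Borel colouring\<close>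
  obtain \<epsilon> \<theta> :: real where \<epsilon>: "0 < \<epsilon>" and \<theta>: "0 < \<theta>" "\<theta> < 1"
    and exponent: "\<And>M w v :: nat. M \<le> w \<Longrightarrow> real v \<le> (1 + \<epsilon>) * w \<Longrightarrow> p ^ w \<le> \<theta> ^ M * q ^ v"
    using boundary_exponent[OF p \<open>q < 1\<close>] by blast
  obtain r where r: "\<And>n v. n > r \<Longrightarrow> real (card (rel_ball S v n)) < (1 + \<epsilon>) ^ n"
    using assms(6) \<epsilon> unfolding rel_unif_subexp_growth_def by blast
  \<comment> \<open>Two clauses in a ball of radius at most \<open>r + 1\<close> are at distance at
    most \<open>2 * r + 2\<close>, and their variables at most one further. As \<open>D > r\<close>,
    the growth bound applies to balls of radius \<open>D\<close> and yields the number
    \<open>k\<close> of colours.\<close>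
  define D where "D = 2 * r + 3"
  define k where "k = nat \<lceil>(1 + \<epsilon>) ^ D\<rceil>"
  define H where "H x = rel_ball S x D - {x}" for x
  have Hdeg: "card (H x) < k" for x
  proof -
    have "card (H x) \<le> card (rel_ball S x D)" unfolding H_def using fin_ball by (intro card_mono) auto
    moreover have "real (card (rel_ball S x D)) < (1 + \<epsilon>) ^ D" by (rule r) (simp add: D_def)
    ultimately show ?thesis unfolding k_def by linarith
  qed
  have Hborel: "borel_multifun H"
    unfolding H_def by (intro borel_multifun_remove_self borel_multifun_rel_ball S symS)
  have Hfin: "x \<notin> H x" "finite (H x)" for x using fin_ball by (simp_all add: H_def)
  have Hsym: "x \<in> H x'" if "x' \<in> H x" for x x' using that rel_ball_sym by (auto simp: H_def)
  obtain c :: "'a \<Rightarrow> nat" where c: "\<And>j. {x. c x = j} \<in> sets borel" "\<And>x. c x < k"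
    and proper: "\<And>x y. y \<in> H x \<Longrightarrow> c y \<noteq> c x"
  proof -
    show thesis using Hborel Hfin(1) Hsym Hfin(2) Hdeg that by (rule borel_finite_coloring) blast+
  qed
  have inj_ball: "inj_on c (rel_ball S v n)" if "n \<le> Suc r" for v n
  proof (rule inj_onI, rule ccontr)
    fix x x' assume x: "x \<in> rel_ball S v n" "x' \<in> rel_ball S v n" "c x = c x'" "x \<noteq> x'"
    have "x' \<in> rel_ball S x (n + n)" by (rule rel_ball_trans[OF rel_ball_sym[OF x(1)] x(2)])
    moreover have "n + n \<le> D" using that by (simp add: D_def)
    ultimately have "x' \<in> H x" using rel_ball_mono[of "n + n" D S x] x(4) by (auto simp: H_def)
    then show False using proper[of x' x] x(3) by simp
  qed
  have inj_nbhd: "inj_on c (\<Union>(?N ` rel_ball S v n))" if "n \<le> Suc r" for v n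
  proof (rule inj_onI, rule ccontr)
    fix z z' assume z: "z \<in> \<Union>(?N ` rel_ball S v n)" "z' \<in> \<Union>(?N ` rel_ball S v n)" "c z = c z'" "z \<noteq> z'"
    then obtain x x' where x: "x \<in> rel_ball S v n" "x' \<in> rel_ball S v n" "z \<in> ?N x" "z' \<in> ?N x'" by blast
    have "x' \<in> rel_ball S x (n + n)" by (rule rel_ball_trans[OF rel_ball_sym[OF x(1)] x(2)])
    then have "z' \<in> rel_ball S z (Suc (n + n))" using x(3,4) by (rule nbhd_in_rel_ball[OF symS])
    moreover have "Suc (n + n) \<le> D" using that by (simp add: D_def)
    ultimately have "z' \<in> H z" using rel_ball_mono[of "Suc (n + n)" D S z] z(4) by (auto simp: H_def)
    then show False using proper[of z' z] z(3) by simp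
  qed

  \<comment> \<open>The cap on resamplings and the seed\<close>
  have "0 < b" using assms(1) by simp
  obtain \<eta> :: real where \<eta>: "\<eta> > 0"
    and seed: "\<forall>n. \<exists>s\<in>{..<k} \<times> {..n} \<rightarrow>\<^sub>E {..<b}. \<forall>X W N F. (X, W, N, F) \<in> patterns k b \<longrightarrow>
      admissible p \<Delta> b (X, W, N, F) \<longrightarrow>
      \<not> (\<exists>I. layered X N I \<and> (\<forall>l>n. I l = {}) \<and>
         p ^ (\<Sum>l\<le>n. card (I l \<inter> W)) \<le> \<eta> * q ^ (\<Sum>l\<le>n. card (I l)) \<and> consistent N F W I s)"
    by (rule good_seed_exists[OF p(1) less_imp_le[OF \<open>0 < q\<close>] y \<open>0 < b\<close>]) (rule that, assumption+)
  \<comment> \<open>The order of choices matters: \<open>\<eta>\<close> is fixed first, then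
    \<open>M\<close> with \<open>\<theta> ^ M \<le> \<eta>\<close>, and last a seed long enough for
    \<open>M\<close>.\<close>
  obtain M0 where M0: "\<theta> ^ M0 < \<eta>" using real_arch_pow_inv[OF \<eta> \<theta>(2)] by blast
  define M where "M = Suc M0"
  have "\<theta> * \<theta> ^ M0 \<le> 1 * \<theta> ^ M0" using \<theta> by (intro mult_right_mono) auto
  then have M: "0 < M" "\<theta> ^ M \<le> \<eta>" using M0 by (auto simp: M_def)
  obtain s where s: "s \<in> {..<k} \<times> {..M * k} \<rightarrow>\<^sub>E {..<b}"
    and good: "\<forall>X W N F. (X, W, N, F) \<in> patterns k b \<longrightarrow> admissible p \<Delta> b (X, W, N, F) \<longrightarrow>
      \<not> (\<exists>I. layered X N I \<and> (\<forall>l>M * k. I l = {}) \<and>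
         p ^ (\<Sum>l\<le>M * k. card (I l \<inter> W)) \<le> \<eta> * q ^ (\<Sum>l\<le>M * k. card (I l)) \<and> consistent N F W I s)"
    using seed[rule_format, of "M * k"] by (elim bexE) (rule that)

  interpret borel_resampling ?N R c k b M s
  proof
    show "borel_multifun ?N" by (rule borel_multifun_nbhd[OF S])
    show "{x. restrict f (?N x) \<in> R x} \<in> sets borel" if "\<And>v. {x. f x = v} \<in> sets borel" for f :: "'a \<Rightarrow> nat"
      using deg by (intro sets_satisfied[where d = \<Delta>, OF S local assms(5) finN _ that]) (simp add: gdeg_def)
  qed (use swap c in auto)

  \<comment> \<open>No clause reaches the cap\<close>
  have less: "clause_count t x < M" for t x
  proof (rule ccontr)
    assume "\<not> clause_count t x < M"
    then have "clause_count t x = M" using clause_count_le[of t x] by simp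
    \<comment> \<open>Around a clause at the cap the total counts start at \<open>M\<close> and are
      at most \<open>M\<close> times the ball size, so slow growth yields a ball with a relatively
      small boundary.\<close>
    define A where "A j = (\<Sum>v\<in>rel_ball S x j. clause_count t v)" for j
    have "A j \<le> A (Suc j)" for j
      unfolding A_def using fin_ball rel_ball_mono[of j "Suc j" S x] by (intro sum_mono2) auto
    moreover have "A 0 = M" using \<open>clause_count t x = M\<close> by (simp add: A_def rel_ball_0)
    moreover have "A (Suc r) \<le> (\<Sum>v\<in>rel_ball S x (Suc r). M)"
      unfolding A_def using clause_count_le by (intro sum_mono)
    then have "real (A (Suc r)) \<le> real M * real (card (rel_ball S x (Suc r)))"
      by (simp add: mult.commute[of _ M] flip: of_nat_mult)
    moreover have "real (card (rel_ball S x (Suc r))) < (1 + \<epsilon>) ^ Suc r" by (rule r) simp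
    ultimately obtain j where j: "j \<le> r" "real (A (Suc j)) \<le> (1 + \<epsilon>) * A j" "M \<le> A j"
      using small_boundary[of A M \<epsilon> r] M(1) \<epsilon> by blast
    have adj_deg: "card {x' \<in> rel_ball S x (Suc j). ?N x' \<inter> ?N v \<noteq> {}} \<le> \<Delta>" if "v \<in> rel_ball S x (Suc j)" for v
    proof -
      have "{x' \<in> rel_ball S x (Suc j). ?N x' \<inter> ?N v \<noteq> {}} \<subseteq> {w. rel_adj S v w}" by (auto simp: rel_adj_def)
      then have "card {x' \<in> rel_ball S x (Suc j). ?N x' \<inter> ?N v \<noteq> {}} \<le> rel_deg S v"
        unfolding rel_deg_def by (rule card_mono[OF fin_adj])
      then show ?thesis using \<Delta>_max le_trans by blast
    qed
    have WX: "z \<in> rel_ball S x (Suc j)" if "v \<in> rel_ball S x j" "w \<in> ?N v" "w \<in> ?N z" for v w z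
      using that by (intro rel_ball_Suc[of v]) (auto simp: rel_adj_def)
    have sub: "rel_ball S x j \<subseteq> rel_ball S x (Suc j)" by (rule rel_ball_mono) simp
    have "Suc j \<le> Suc r" using j(1) by simp
    obtain X W N' F' I where pat: "(X, W, N', F') \<in> patterns k b" "admissible p \<Delta> b (X, W, N', F')"
      "layered X N' I" "\<And>l. l > M * k \<Longrightarrow> I l = {}" "consistent N' F' W I s"
      "(\<Sum>l\<le>M * k. card (I l \<inter> W)) = (\<Sum>v\<in>rel_ball S x j. clause_count t v)"
      "(\<Sum>l\<le>M * k. card (I l)) = (\<Sum>v\<in>rel_ball S x (Suc j). clause_count t v)"
    proof -
      show thesis
        using sub fin_ball inj_ball[OF \<open>Suc j \<le> Suc r\<close>] inj_nbhd[OF \<open>Suc j \<le> Suc r\<close>] WX isolated c(2)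
          finN forbidden adj_deg s that
        by (rule pattern_of_run) blast+
    qed
    \<comment> \<open>Since \<open>A j\<close> counts the inner resamplings and
      \<open>A (Suc j)\<close> all of them, this run has a history of the kind that the seed
      excludes.\<close>
    have "p ^ A j \<le> \<theta> ^ M * q ^ A (Suc j)" using exponent j by blast
    also have "\<dots> \<le> \<eta> * q ^ A (Suc j)" using M(2) \<open>0 < q\<close> by (intro mult_right_mono) auto
    finally have "\<exists>I. layered X N' I \<and> (\<forall>l>M * k. I l = {}) \<and>
        p ^ (\<Sum>l\<le>M * k. card (I l \<inter> W)) \<le> \<eta> * q ^ (\<Sum>l\<le>M * k. card (I l)) \<and> consistent N' F' W I s"
      using pat(3-7) by (intro exI[of _ I]) (simp add: A_def)
    then show False using good[rule_format, OF pat(1,2)] by contradiction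
  qed

  \<comment> \<open>The limit function\<close>
  define f where "f y = entry (y, limit_count y)" for y
  have "f \<in> borel_measurable borel"
  proof (rule borel_measurableI)
    fix V :: "nat set"
    have "f -` V \<inter> space borel = (\<Union>v\<in>V. {y. f y = v})" by auto
    also have "\<dots> \<in> sets borel"
      using borel_limit[OF finN] unfolding f_def by (intro sets.countable_UN') auto
    finally show "f -` V \<inter> space borel \<in> sets borel" .
  qed
  moreover have "f x < b" for x using \<open>0 < b\<close> by (simp add: f_def entry_def)
  moreover have "satisfies_rule S R f"
    unfolding satisfies_rule_def f_def using limit_satisfies[OF finN swap less c(2)] by simp
  ultimately show ?thesis by blast
qed

end
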